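(* Let $X$ be a based, connected, locally compact Hausdorff space. Then the $n$-fold symmetric join $\mathrm{Sym}^{*n}(X)$ is simply connected for every $n\geq2$.
   Context: Iterated join: $X^{*n}=(X^n\times\Delta_{n-1})/\sim$ with $\Delta_{n-1}=\{(t_1,\ldots,t_n):t_i\in[0,1],\sum t_i=1\}$ and $(x_1,\ldots,x_n;t_1,\ldots,t_n)\sim(x_1',\ldots,x_n';t_1,\ldots,t_n)$ whenever $x_j=x_j'$ for all $j$ with $t_j\neq0$. Symmetric join: $\mathrm{Sym}^{*n}(X)=X^{*n}/\mathfrak S_n$, with $\mathfrak S_n$ simultaneously permuting the $x_i$ and $t_i$. In the paper "connected" is used for path-connected. *)

theory Defs
  imports "HOL-Analysis.Analysis" "HOL-Homology.Simplices" "HOL-Combinatorics.Permutations"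
begin

definition quotient_topology :: "'a topology \<Rightarrow> ('a \<times> 'a) set \<Rightarrow> 'a set topology" where
  "quotient_topology T R =
     topology (\<lambda>U. U \<subseteq> topspace T // R \<and> openin T {x \<in> topspace T. R `` {x} \<in> U})"

lemma istopology_quotient:
  "istopology (\<lambda>U. U \<subseteq> topspace T // R \<and> openin T {x \<in> topspace T. R `` {x} \<in> U})"
proof -
  have 1: "{x \<in> topspace T. R `` {x} \<in> S \<inter> S'} =
      {x \<in> topspace T. R `` {x} \<in> S} \<inter> {x \<in> topspace T. R `` {x} \<in> S'}" for S S'
    by auto
  have 2: "{x \<in> topspace T. R `` {x} \<in> \<Union>K} = (\<Union>S\<in>K. {x \<in> topspace T. R `` {x} \<in> S})" for K
    by auto
  show ?thesis
    unfolding istopology_def 1 2 by (intro conjI allI impI openin_Union) (blast | auto)+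
qed

lemma openin_quotient_topology:
  "openin (quotient_topology T R) U \<longleftrightarrow>
     U \<subseteq> topspace T // R \<and> openin T {x \<in> topspace T. R `` {x} \<in> U}"
  unfolding quotient_topology_def using istopology_quotient[of T R] by (simp add: topology_inverse')

lemma topspace_quotient_topology [simp]: "topspace (quotient_topology T R) = topspace T // R"
proof
  have "{x \<in> topspace T. R `` {x} \<in> topspace T // R} = topspace T"
    by (auto simp: quotientI)
  then have "openin (quotient_topology T R) (topspace T // R)"
    by (simp add: openin_quotient_topology)
  then show "topspace T // R \<subseteq> topspace (quotient_topology T R)"
    by (rule openin_subset)
  show "topspace (quotient_topology T R) \<subseteq> topspace T // R"
    using openin_quotient_topology openin_topspace by blast
qed

lemma quotient_map_quotient_topology:
  "quotient_map T (quotient_topology T R) (\<lambda>x. R `` {x})"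
  unfolding quotient_map_def by (auto simp: openin_quotient_topology quotient_def)

text \<open>A point of \<open>X\<^sup>n \<times> \<Delta>\<^bsub>n-1\<^esub>\<close> is a pair \<open>(x, t)\<close> of functions on the naturals whose coordinates
  are indexed by \<open>{..<n}\<close>; from index \<open>n\<close> on, \<open>x\<close> is undefined and \<open>t\<close> is zero. The truncated
  subtraction \<open>n - 1\<close> is only meaningful for positive \<open>n\<close>.\<close>

definition prejoin :: "'a topology \<Rightarrow> nat \<Rightarrow> ((nat \<Rightarrow> 'a) \<times> (nat \<Rightarrow> real)) topology" where
  "prejoin X n = prod_topology (product_topology (\<lambda>_. X) {..<n})
     (subtopology (powertop_real UNIV) (standard_simplex (n - 1)))"

definition join_rel ::
  "'a topology \<Rightarrow> nat \<Rightarrow> (((nat \<Rightarrow> 'a) \<times> (nat \<Rightarrow> real)) \<times> ((nat \<Rightarrow> 'a) \<times> (nat \<Rightarrow> real))) set" where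
  "join_rel X n = {((x, t), (x', t')).
     (x, t) \<in> topspace (prejoin X n) \<and> (x', t') \<in> topspace (prejoin X n) \<and>
     t = t' \<and> (\<forall>i<n. t i \<noteq> 0 \<longrightarrow> x i = x' i)}"

definition iterated_join :: "'a topology \<Rightarrow> nat \<Rightarrow> ((nat \<Rightarrow> 'a) \<times> (nat \<Rightarrow> real)) set topology" where
  "iterated_join X n = quotient_topology (prejoin X n) (join_rel X n)"

definition permute_coords ::
  "(nat \<Rightarrow> nat) \<Rightarrow> (nat \<Rightarrow> 'a) \<times> (nat \<Rightarrow> real) \<Rightarrow> (nat \<Rightarrow> 'a) \<times> (nat \<Rightarrow> real)" where
  "permute_coords \<sigma> = (\<lambda>(x, t). (x \<circ> \<sigma>, t \<circ> \<sigma>))"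

text \<open>The orbit relation of the symmetric group on the iterated join. Points of the join are
  equivalence classes, on which a permutation acts by taking images.\<close>

definition sym_rel ::
  "'a topology \<Rightarrow> nat \<Rightarrow>
   (((nat \<Rightarrow> 'a) \<times> (nat \<Rightarrow> real)) set \<times> ((nat \<Rightarrow> 'a) \<times> (nat \<Rightarrow> real)) set) set" where
  "sym_rel X n = {(c, d). c \<in> topspace (iterated_join X n) \<and> d \<in> topspace (iterated_join X n) \<and>
     (\<exists>\<sigma>. \<sigma> permutes {..<n} \<and> d = permute_coords \<sigma> ` c)}"

definition symmetric_join ::
  "'a topology \<Rightarrow> nat \<Rightarrow> ((nat \<Rightarrow> 'a) \<times> (nat \<Rightarrow> real)) set set topology" where
  "symmetric_join X n = quotient_topology (iterated_join X n) (sym_rel X n)"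

lemma equiv_join_rel: "equiv (topspace (prejoin X n)) (join_rel X n)"
  unfolding join_rel_def
  by (rule equivI) (auto simp: refl_on_def sym_def trans_def)

lemma permute_coords_prejoin:
  assumes "\<sigma> permutes {..<n}" "n \<ge> 1" "z \<in> topspace (prejoin X n)"
  shows "permute_coords \<sigma> z \<in> topspace (prejoin X n)"
proof -
  obtain x t where z: "z = (x, t)" by fastforce
  have x: "x \<in> {..<n} \<rightarrow>\<^sub>E topspace X" and t: "t \<in> standard_simplex (n - 1)"
    using assms(3) by (auto simp: z prejoin_def)
  have n: "{..n - 1} = {..<n}" using assms(2) by auto
  have "(\<Sum>i<n. t (\<sigma> i)) = (\<Sum>i<n. t i)"
    using sum.permute[OF assms(1), of t] by (simp add: o_def)
  moreover have "t (\<sigma> i) = 0" if "i > n - 1" for i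
    using that t assms(1,2) by (auto simp: standard_simplex_def permutes_def)
  ultimately have "t \<circ> \<sigma> \<in> standard_simplex (n - 1)"
    using t by (auto simp: standard_simplex_def n simp flip: One_nat_def)
  moreover have "x \<circ> \<sigma> \<in> {..<n} \<rightarrow>\<^sub>E topspace X"
    using x permutes_in_image[OF assms(1)] permutes_not_in[OF assms(1)]
    by (auto simp: PiE_iff extensional_def)
  ultimately show ?thesis by (simp add: z prejoin_def permute_coords_def)
qed

lemma permute_coords_class:
  assumes "\<sigma> permutes {..<n}" "n \<ge> 1" "z \<in> topspace (prejoin X n)"
  shows "permute_coords \<sigma> ` (join_rel X n `` {z}) = join_rel X n `` {permute_coords \<sigma> z}"
proof -
  have fwd: "(permute_coords \<tau> z, permute_coords \<tau> w) \<in> join_rel X n"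
    if "\<tau> permutes {..<n}" "(z, w) \<in> join_rel X n" for \<tau> z and w :: "(nat \<Rightarrow> 'a) \<times> (nat \<Rightarrow> real)"
    using that permute_coords_prejoin[OF that(1) assms(2)] permutes_in_image[OF that(1)]
    unfolding join_rel_def by (auto simp: permute_coords_def split: prod.splits)
  have inverse: "permute_coords (inv_into UNIV \<sigma>) (permute_coords \<sigma> w) = w"
       "permute_coords \<sigma> (permute_coords (inv_into UNIV \<sigma>) w) = w" for w :: "(nat \<Rightarrow> 'a) \<times> (nat \<Rightarrow> real)"
    by (auto simp: permute_coords_def o_assoc[symmetric] permutes_inv_o[OF assms(1)] split: prod.splits)
  show ?thesis
  proof
    show "permute_coords \<sigma> ` (join_rel X n `` {z}) \<subseteq> join_rel X n `` {permute_coords \<sigma> z}"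
      using fwd[OF assms(1)] by auto
    show "join_rel X n `` {permute_coords \<sigma> z} \<subseteq> permute_coords \<sigma> ` (join_rel X n `` {z})"
    proof
      fix w assume "w \<in> join_rel X n `` {permute_coords \<sigma> z}"
      then have "(z, permute_coords (inv_into UNIV \<sigma>) w) \<in> join_rel X n"
        using fwd[OF permutes_inv[OF assms(1)], of "permute_coords \<sigma> z" w] by (simp add: inverse)
      then show "w \<in> permute_coords \<sigma> ` (join_rel X n `` {z})"
        using inverse(2)[of w] by (metis Image_singleton_iff imageI)
    qed
  qed
qed

lemma equiv_sym_rel: "equiv (topspace (iterated_join X n)) (sym_rel X n)"
proof (rule equivI)
  show "sym_rel X n \<subseteq> topspace (iterated_join X n) \<times> topspace (iterated_join X n)"
    by (auto simp: sym_rel_def)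
  have comp: "permute_coords \<tau> ` permute_coords \<sigma> ` c = permute_coords (\<sigma> \<circ> \<tau>) ` c"
    for \<sigma> \<tau> and c :: "((nat \<Rightarrow> 'a) \<times> (nat \<Rightarrow> real)) set"
    by (force simp: permute_coords_def image_image o_assoc case_prod_unfold)
  have id: "permute_coords id ` c = c" for c :: "((nat \<Rightarrow> 'a) \<times> (nat \<Rightarrow> real)) set"
    by (auto simp: permute_coords_def)
  show "refl_on (topspace (iterated_join X n)) (sym_rel X n)"
    unfolding refl_on_def sym_rel_def by clarsimp (metis id permutes_id)
  show "sym (sym_rel X n)"
    unfolding sym_def sym_rel_def
    by clarsimp (metis comp id permutes_inv permutes_inv_o(1))
  show "trans (sym_rel X n)"
    unfolding trans_def sym_rel_def by clarsimp (metis comp permutes_compose)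
qed

text \<open>Path-connected (hence, by convention, nonempty) with trivial fundamental group at every
  base point.\<close>

definition simply_connected_space :: "'a topology \<Rightarrow> bool" where
  "simply_connected_space X \<longleftrightarrow>
     topspace X \<noteq> {} \<and> path_connected_space X \<and>
     (\<forall>a \<in> topspace X. \<forall>p. pathin X p \<and> p 0 = a \<and> p 1 = a \<longrightarrow>
        homotopic_with (\<lambda>r. r 0 = a \<and> r 1 = a) (top_of_set {0..1}) X p (\<lambda>_. a))"

lemma simply_connected_space_top_of_set:
  fixes S :: "'a::real_normed_vector set"
  shows "simply_connected_space (top_of_set S) \<longleftrightarrow> S \<noteq> {} \<and> simply_connected S"
proof -
  have p: "pathin (top_of_set S) p \<longleftrightarrow> path p \<and> path_image p \<subseteq> S" for p :: "real \<Rightarrow> 'a"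
    by (auto simp: pathin_def path_def path_image_def image_subset_iff_funcset)
  have l: "linepath a a = (\<lambda>_. a)" for a :: 'a
    by (auto simp: linepath_def algebra_simps)
  have "path_image p \<subseteq> S \<Longrightarrow> p 0 \<in> S" for p :: "real \<Rightarrow> 'a"
    by (auto simp: path_image_def)
  then show ?thesis
    unfolding simply_connected_space_def simply_connected_eq_contractible_path p
      homotopic_paths_def pathstart_def pathfinish_def l
    by (auto simp: path_connectedin_topspace[symmetric] simp del: path_connectedin_topspace)
qed

end

theory Submission
  imports Defs
begin

text \<open>A point of the symmetric join is a finite configuration of points of \<open>X\<close> carrying weights that
  sum to one. The minimal weight \<open>\<mu>\<close> of the \<open>n\<close> slots is a continuous function, and the join is covered
  by the open sets \<open>A = {\<mu> < 1/n}\<close> and \<open>B = {\<mu> > 0}\<close>. Every point is joined to a base point by a path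
  that stays in \<open>A\<close> and in \<open>B\<close> whenever the point does, so by the elementary half of van Kampen's theorem
  it suffices to contract loops lying in \<open>A\<close> or in \<open>B\<close>.

  The set \<open>A\<close> contracts in the join: lower all weights until a slot becomes empty, then let \<open>x\<^sub>0\<close> enter
  that slot and absorb all the weight. A loop in \<open>B\<close> is a loop of configurations of exactly \<open>n\<close> points
  of the Hausdorff space \<open>X \<times> \<real>\<close>, and such a path lifts to \<open>n\<close> continuous paths, with no local
  assumption on \<open>X\<close>: by induction on \<open>n\<close>, the lift exists locally where the configuration has two
  distinct points, because it splits, and where all points coincide continuity is automatic. The lift
  closes up to a permutation of the slots, which allows the weight to be pushed along an edge of the
  simplex, after which the loop can be shrunk explicitly.\<close>

subsection \<open>Path homotopy in abstract topologies\<close>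

text \<open>Coordinates are not functions on the symmetric join: the order of the slots is lost, and
  so is every point of weight zero. Maps out of the join are therefore built on representatives and
  must be shown to descend. The two sets separate the difficulties. On \<open>B\<close> no point is
  forgotten, so only the order is ambiguous. On \<open>A\<close> the \<open>n\<close> slots together
  can give up \<open>n * \<mu> < 1\<close> of weight, so the remaining weights can be rescaled. The
  slot to be emptied is ambiguous only between tied slots, and tied slots become empty at the same
  time.

  For a lifted loop in \<open>B\<close> with closing permutation \<open>\<sigma>\<close>, the edge
  of the simplex is dictated by \<open>\<sigma>\<close>: it runs from vertex \<open>0\<close> to the
  vertex \<open>k\<close> with \<open>\<sigma> k = 0\<close>, so that moving the weights onto it
  keeps the loop closed. If \<open>k = 0\<close>, what remains is a loop of a single point of full
  weight. It may be essential in \<open>X\<close>, but since \<open>n \<ge> 2\<close> another slot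
  is empty, so it lies in \<open>A\<close> and dies there. If \<open>k \<noteq> 0\<close>, the two
  weighted points can be slid to a common point because each has weight zero at one end.\<close>

abbreviation unit_square :: "(real \<times> real) set" where
  "unit_square \<equiv> {0..1} \<times> {0..1}"

definition path_homotopic :: "'a topology \<Rightarrow> 'a \<Rightarrow> 'a \<Rightarrow> (real \<Rightarrow> 'a) \<Rightarrow> (real \<Rightarrow> 'a) \<Rightarrow> bool" where
  "path_homotopic S a b p q \<longleftrightarrow>
     homotopic_with (\<lambda>r. r 0 = a \<and> r 1 = b) (top_of_set {0..1}) S p q"

lemma path_homotopic_iff:
  "path_homotopic S a b p q \<longleftrightarrow>
     (\<exists>h. continuous_map (top_of_set unit_square) S h \<and>
        (\<forall>s\<in>{0..1}. h (0, s) = p s \<and> h (1, s) = q s) \<and>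
        (\<forall>u\<in>{0..1}. h (u, 0) = a \<and> h (u, 1) = b))"
  unfolding path_homotopic_def
  by (subst homotopic_with) (auto simp: prod_topology_subtopology_eu)

lemma path_homotopic_trans [trans]:
  "path_homotopic S a b p q \<Longrightarrow> path_homotopic S a b q r \<Longrightarrow> path_homotopic S a b p r"
  unfolding path_homotopic_def by (rule homotopic_with_trans)

lemma path_homotopic_cong:
  assumes "path_homotopic S a b p q"
    and "\<And>s. 0 \<le> s \<Longrightarrow> s \<le> 1 \<Longrightarrow> p' s = p s" "\<And>s. 0 \<le> s \<Longrightarrow> s \<le> 1 \<Longrightarrow> q' s = q s"
  shows "path_homotopic S a b p' q'"
  using assms unfolding path_homotopic_iff by (elim ex_forward) auto

text \<open>The straight-line homotopy between the two curves stays in the convex set and is pushed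
  forward by \<open>g\<close>. The end points agree, so they do not move.\<close>

lemma path_homotopic_compose_convex:
  fixes r r' :: "real \<Rightarrow> 'b::real_normed_vector"
  assumes K: "convex K" and g: "continuous_map (top_of_set K) S g"
    and r: "continuous_on {0..1} r" "r ` {0..1} \<subseteq> K"
    and r': "continuous_on {0..1} r'" "r' ` {0..1} \<subseteq> K"
    and eq: "r 0 = r' 0" "r 1 = r' 1"
  shows "path_homotopic S (g (r 0)) (g (r 1)) (g \<circ> r) (g \<circ> r')"
proof -
  let ?k = "\<lambda>(u, s). (1 - u) *\<^sub>R r s + u *\<^sub>R r' s"
  have "continuous_on unit_square ?k"
    unfolding case_prod_unfold
    by (intro continuous_intros continuous_on_compose2[OF r(1)] continuous_on_compose2[OF r'(1)]) auto
  moreover have "?k ` unit_square \<subseteq> K"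
    using K r(2) r'(2) by (auto simp: image_subset_iff intro!: convexD)
  ultimately have "continuous_map (top_of_set unit_square) (top_of_set K) ?k"
    by (simp add: image_subset_iff_funcset)
  from continuous_map_compose[OF this g] show ?thesis
    unfolding path_homotopic_iff
    by (rule_tac x = "g \<circ> ?k" in exI) (auto simp: eq scaleR_left_distrib[symmetric])
qed

text \<open>The form in which homotopies are produced below: two paths are recognised as values of
  one map \<open>p\<close> along two curves in an interval or in the unit square.\<close>

lemma path_homotopic_reparam:
  fixes r r' :: "real \<Rightarrow> 'b::real_normed_vector"
  assumes p: "continuous_map (top_of_set K) S p" and "convex K"
    and "continuous_on {0..1} r" "r ` {0..1} \<subseteq> K" "continuous_on {0..1} r'" "r' ` {0..1} \<subseteq> K"
    and "r 0 = r' 0" "r 1 = r' 1"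
    and "\<And>s. 0 \<le> s \<Longrightarrow> s \<le> 1 \<Longrightarrow> f s = p (r s)" "\<And>s. 0 \<le> s \<Longrightarrow> s \<le> 1 \<Longrightarrow> f' s = p (r' s)"
    and "a = p (r 0)" "b = p (r 1)"
  shows "path_homotopic S a b f f'"
  using path_homotopic_compose_convex[OF assms(2,1,3-8)] assms(9-)
  by (auto elim!: path_homotopic_cong)

text \<open>The counterpart of \<open>+++\<close> for paths in a \<open>topology\<close>
  value.\<close>

definition pjoin :: "(real \<Rightarrow> 'a) \<Rightarrow> (real \<Rightarrow> 'a) \<Rightarrow> real \<Rightarrow> 'a" where
  "pjoin p q = (\<lambda>s. if s \<le> 1/2 then p (2 * s) else q (2 * s - 1))"

lemma continuous_map_pjoin:
  assumes p: "continuous_map (top_of_set {0..1}) S p" and q: "continuous_map (top_of_set {0..1}) S q"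
    and "p 1 = q 0"
  shows "continuous_map (top_of_set {0..1}) S (pjoin p q)"
  unfolding pjoin_def
proof (rule continuous_map_cases_le)
  show "continuous_map (subtopology (top_of_set {0..1}) {x \<in> topspace (top_of_set {0..1}). x \<le> 1 / 2}) S (\<lambda>s. p (2 * s))"
    by (rule continuous_map_compose[OF _ p, unfolded o_def])
      (auto simp: subtopology_subtopology intro!: continuous_intros)
  show "continuous_map (subtopology (top_of_set {0..1}) {x \<in> topspace (top_of_set {0..1}). 1 / 2 \<le> x}) S (\<lambda>s. q (2 * s - 1))"
    by (rule continuous_map_compose[OF _ q, unfolded o_def])
      (auto simp: subtopology_subtopology intro!: continuous_intros)
qed (use assms in \<open>auto simp: mult.commute\<close>)

lemma pjoin_image_subset:
  assumes "p ` {0..1} \<subseteq> K" "q ` {0..1} \<subseteq> K"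
  shows "pjoin p q ` {0..1} \<subseteq> K"
  using assms by (auto simp: pjoin_def image_subset_iff)

lemma path_homotopic_pjoin:
  assumes "path_homotopic S a b p p'" "path_homotopic S b c q q'"
  shows "path_homotopic S a c (pjoin p q) (pjoin p' q')"
proof -
  obtain h where h: "continuous_map (top_of_set unit_square) S h"
    "\<And>s. s \<in> {0..1} \<Longrightarrow> h (0, s) = p s \<and> h (1, s) = p' s"
    "\<And>u. u \<in> {0..1} \<Longrightarrow> h (u, 0) = a \<and> h (u, 1) = b"
    using assms(1) unfolding path_homotopic_iff by metis
  obtain k where k: "continuous_map (top_of_set unit_square) S k"
    "\<And>s. s \<in> {0..1} \<Longrightarrow> k (0, s) = q s \<and> k (1, s) = q' s"
    "\<And>u. u \<in> {0..1} \<Longrightarrow> k (u, 0) = b \<and> k (u, 1) = c"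
    using assms(2) unfolding path_homotopic_iff by metis
  let ?l = "\<lambda>x. if snd x \<le> 1/2 then h (fst x, 2 * snd x) else k (fst x, 2 * snd x - 1)"
  let ?I = "top_of_set unit_square"
  have "continuous_map ?I S ?l"
  proof (rule continuous_map_cases_le)
    show "continuous_map (subtopology ?I {x \<in> topspace ?I. snd x \<le> 1 / 2}) S (\<lambda>x. h (fst x, 2 * snd x))"
      by (rule continuous_map_compose[OF _ h(1), unfolded o_def])
        (auto simp: subtopology_subtopology intro!: continuous_intros)
    show "continuous_map (subtopology ?I {x \<in> topspace ?I. 1 / 2 \<le> snd x}) S (\<lambda>x. k (fst x, 2 * snd x - 1))"
      by (rule continuous_map_compose[OF _ k(1), unfolded o_def])
        (auto simp: subtopology_subtopology intro!: continuous_intros)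
  qed (use h(3) k(3) in \<open>auto simp: mult.commute intro!: continuous_intros\<close>)
  then show ?thesis
    unfolding path_homotopic_iff
    by (rule_tac x = ?l in exI) (auto simp: h k pjoin_def)
qed

text \<open>The loop traversed along the bottom of the square is homotopic to the path along the other three
  sides, which runs out and back along the common trace of the end points.\<close>

lemma loop_nullhomotopic_if_freely:
  assumes h: "continuous_map (top_of_set unit_square) S h"
    and 0: "\<And>s. s \<in> {0..1} \<Longrightarrow> h (0, s) = p s" and 1: "\<And>s. s \<in> {0..1} \<Longrightarrow> h (1, s) = z"
    and ends: "\<And>u. u \<in> {0..1} \<Longrightarrow> h (u, 0) = h (u, 1)"
  shows "path_homotopic S (p 0) (p 0) p (\<lambda>_. p 0)"
proof -
  \<comment> \<open>One third of the time for each side: \<open>?r\<close> runs along the side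
    \<open>s = 0\<close>, then \<open>u = 1\<close>, then back along \<open>s = 1\<close>. On the
    last third \<open>ends\<close> replaces the side \<open>s = 1\<close> by \<open>s = 0\<close>,
    and in the middle \<open>h\<close> is constant, which gives \<open>hr\<close>.\<close>
  let ?c = "\<lambda>s::real. min 1 (min (3 * s) (3 - 3 * s))"
  let ?r = "\<lambda>s::real. (?c s, min 1 (max 0 (3 * s - 1)))"
  have p1: "p 1 = p 0"
    using 0[of 0] 0[of 1] ends[of 0] by simp
  have hr: "h (?c s, 0) = h (?r s)" if "0 \<le> s" "s \<le> 1" for s
  proof (cases "s \<le> 1/3 \<or> s \<ge> 2/3")
    case True
    then consider "s \<le> 1/3" "?r s = (?c s, 0)" | "?r s = (?c s, 1)"
      using that by auto
    then show ?thesis using that ends[of "?c s"] by cases auto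
  next
    case False
    then have "?c s = 1" "0 \<le> 3 * s - 1" "3 * s - 1 \<le> 1" by auto
    then show ?thesis using 1 by auto
  qed
  have "path_homotopic S (p 0) (p 0) p (\<lambda>s. h (?c s, 0))"
    by (rule path_homotopic_reparam[OF h, where r = "\<lambda>s. (0, s)" and r' = ?r])
      (use 0 p1 hr in \<open>auto intro!: continuous_intros convex_Times\<close>)
  moreover have "path_homotopic S (p 0) (p 0) (\<lambda>s. h (?c s, 0)) (\<lambda>_. p 0)"
    by (rule path_homotopic_reparam[OF h, where r = "\<lambda>s. (?c s, 0)" and r' = "\<lambda>_. (0, 0)"])
      (use 0 in \<open>auto intro!: continuous_intros convex_Times\<close>)
  ultimately show ?thesis by (rule path_homotopic_trans)
qed

lemma clamp_bounds: "0 \<le> max 0 (min 1 x)" "max 0 (min 1 x) \<le> 1" "0 \<le> min 1 (max 0 x)" "min 1 (max 0 x) \<le> 1"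
  for x :: real
  by (auto simp: le_max_iff_disj min_le_iff_disj)

text \<open>In the square of the null-homotopy, \<open>p\<close> is the lower half of the side
  \<open>u = 0\<close>. The rest of the boundary connects the same two points; it is constant on
  three sides and then traverses \<open>q\<close> on the upper half. The curve \<open>?r\<close>
  spends a quarter of the time on each piece, whence the delayed path
  \<open>q (max 0 (4 * s - 3))\<close>.\<close>

lemma path_homotopic_if_loop_null:
  assumes p: "continuous_map (top_of_set {0..1}) S p" and q: "continuous_map (top_of_set {0..1}) S q"
    and eq: "p 0 = q 0" "p 1 = q 1"
    and null: "path_homotopic S (p 0) (p 0) (pjoin p (\<lambda>s. q (1 - s))) (\<lambda>_. p 0)"
  shows "path_homotopic S (p 0) (p 1) p q"
proof -
  obtain h where h: "continuous_map (top_of_set unit_square) S h"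
    "\<And>s. s \<in> {0..1} \<Longrightarrow> h (0, s) = pjoin p (\<lambda>s. q (1 - s)) s \<and> h (1, s) = p 0"
    "\<And>u. u \<in> {0..1} \<Longrightarrow> h (u, 0) = p 0 \<and> h (u, 1) = p 0"
    using null unfolding path_homotopic_iff by metis
  let ?r = "\<lambda>s::real. (max 0 (min 1 (min (4 * s) (3 - 4 * s))), min 1 (max 0 (min (4 * s - 1) (5/2 - 2 * s))))"
  have hr: "q (max 0 (4 * s - 3)) = h (?r s)" if s: "0 \<le> s" "s \<le> 1" for s
  proof -
    consider "s \<le> 1/4" | "1/4 \<le> s" "s \<le> 1/2" | "1/2 \<le> s" "s \<le> 3/4" | "3/4 < s"
      by linarith
    then show ?thesis
    proof cases
      case 1
      then have "?r s = (4 * s, 0)" "max 0 (4 * s - 3) = 0" using s by auto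
      then show ?thesis using h(3)[of "4 * s"] s 1 eq by simp
    next
      case 2
      then have "?r s = (1, 4 * s - 1)" "max 0 (4 * s - 3) = 0" using s by auto
      then show ?thesis using h(2)[of "4 * s - 1"] s 2 eq by simp
    next
      case 3
      then have "?r s = (3 - 4 * s, 1)" "max 0 (4 * s - 3) = 0" using s by auto
      then show ?thesis using h(3)[of "3 - 4 * s"] s 3 eq by simp
    next
      case 4
      then have "?r s = (0, 5/2 - 2 * s)" "max 0 (4 * s - 3) = 4 * s - 3" using s by auto
      moreover have "1 - (2 * (5/2 - 2 * s) - 1) = 4 * s - 3" by simp
      ultimately show ?thesis using h(2)[of "5/2 - 2 * s"] s 4 eq
        by (auto simp: pjoin_def)
    qed
  qed
  have "path_homotopic S (p 0) (p 1) p (\<lambda>s. q (max 0 (4 * s - 3)))"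
  proof (rule path_homotopic_reparam[OF h(1), where r = "\<lambda>s. (0, s / 2)" and r' = ?r])
    show "?r ` {0..1} \<subseteq> unit_square"
      by (simp add: image_subset_iff clamp_bounds)
    show "q (max 0 (4 * s - 3)) = h (?r s)" if "0 \<le> s" "s \<le> 1" for s
      using that by (rule hr)
  qed (use h(2)[of 0] h(3)[of 0] h(2)[of "1/2"] in \<open>simp_all add: h pjoin_def image_subset_iff continuous_intros convex_Times\<close>)
  moreover have "path_homotopic S (p 0) (p 1) (\<lambda>s. q (max 0 (4 * s - 3))) q"
    by (rule path_homotopic_reparam[OF q, where r = "\<lambda>s. max 0 (4 * s - 3)" and r' = "\<lambda>s. s"])
      (use eq in \<open>auto intro!: continuous_intros\<close>)
  ultimately show ?thesis by (rule path_homotopic_trans)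
qed

text \<open>Left cancellation of \<open>c\<close>. In the square of the given homotopy,
  \<open>p\<close> is the upper half of the side \<open>u = 0\<close>; the rest of the boundary
  traverses \<open>c\<close> backwards, rests at \<open>c 0\<close>, traverses \<open>c\<close>
  forwards and rests at \<open>c 1\<close>. This is \<open>c\<close> along the function
  \<open>?w\<close>, which runs from 1 to 0 and back and can be contracted in the unit
  interval.\<close>

lemma loop_null_if_absorbed:
  assumes c: "continuous_map (top_of_set {0..1}) S c"
    and p: "p 0 = c 1" "p 1 = c 1"
    and absorb: "path_homotopic S (c 0) (c 1) (pjoin c p) c"
  shows "path_homotopic S (c 1) (c 1) p (\<lambda>_. c 1)"
proof -
  obtain h where h: "continuous_map (top_of_set unit_square) S h"
    "\<And>s. s \<in> {0..1} \<Longrightarrow> h (0, s) = pjoin c p s \<and> h (1, s) = c s"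
    "\<And>u. u \<in> {0..1} \<Longrightarrow> h (u, 0) = c 0 \<and> h (u, 1) = c 1"
    using absorb unfolding path_homotopic_iff by metis
  let ?w = "\<lambda>s::real. min 1 (max 0 (max (1 - 4 * s) (4 * s - 2)))"
  let ?r = "\<lambda>s::real. (max 0 (min 1 (min (4 * s - 1) (4 - 4 * s))), max (1/2 - 2 * s) (min 1 (max 0 (4 * s - 2))))"
  have hr: "c (?w s) = h (?r s)" if s: "0 \<le> s" "s \<le> 1" for s
  proof -
    consider "s \<le> 1/4" | "1/4 \<le> s" "s \<le> 1/2" | "1/2 \<le> s" "s \<le> 3/4" | "3/4 < s"
      by linarith
    then show ?thesis
    proof cases
      case 1
      then have "?r s = (0, 1/2 - 2 * s)" "?w s = 1 - 4 * s" using s by (auto simp: max_def min_def)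
      then show ?thesis using h(2)[of "1/2 - 2 * s"] s 1
        by (simp add: pjoin_def)
    next
      case 2
      then have "?r s = (4 * s - 1, 0)" "?w s = 0" using s by (auto simp: max_def min_def)
      then show ?thesis using h(3)[of "4 * s - 1"] s 2 by simp
    next
      case 3
      then have "?r s = (1, 4 * s - 2)" "?w s = 4 * s - 2" using s by (auto simp: max_def min_def)
      then show ?thesis using h(2)[of "4 * s - 2"] s 3 by simp
    next
      case 4
      then have "?r s = (4 - 4 * s, 1)" "?w s = 1" using s by (auto simp: max_def min_def)
      then show ?thesis using h(3)[of "4 - 4 * s"] s 4 by simp
    qed
  qed
  have "path_homotopic S (c 1) (c 1) p (\<lambda>s. c (?w s))"
  proof (rule path_homotopic_reparam[OF h(1), where r = "\<lambda>s. (0, (1 + s) / 2)" and r' = ?r])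
    show "p s = h (0, (1 + s) / 2)" if "0 \<le> s" "s \<le> 1" for s
      using that h(2)[of "(1 + s) / 2"] p by (auto simp: pjoin_def field_simps)
    show "?r ` {0..1} \<subseteq> unit_square"
    proof -
      have "max (1/2 - 2 * s) (min 1 (max 0 (4 * s - 2))) \<in> {0..1}" if "0 \<le> s" for s :: real
        using that clamp_bounds[of "4 * s - 2"] by (auto simp: le_max_iff_disj)
      then show ?thesis by (simp add: image_subset_iff clamp_bounds)
    qed
    show "c (?w s) = h (?r s)" if "0 \<le> s" "s \<le> 1" for s
      using that by (rule hr)
  qed (use h(2)[of "1/2"] h(3)[of 0] h(2)[of 1] p in \<open>simp_all add: pjoin_def image_subset_iff continuous_intros convex_Times\<close>)
  moreover have "path_homotopic S (c 1) (c 1) (\<lambda>s. c (?w s)) (\<lambda>_. c 1)"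
    by (rule path_homotopic_reparam[OF c, where r = ?w and r' = "\<lambda>_. 1"])
      (simp_all add: continuous_intros image_subset_iff clamp_bounds)
  ultimately show ?thesis by (rule path_homotopic_trans)
qed

text \<open>One chosen path \<open>c y\<close> serves both sets at points of the overlap, so the
  choice does not depend on which set a piece of the loop is assigned to. On a short piece of
  \<open>p\<close> inside one set, the path to its start, the piece and the path to its end all lie
  in that set and cancel by \<open>loops\<close>. Chaining such pieces shows that
  \<open>c (p 0)\<close> absorbs the whole loop \<open>p\<close>.\<close>

theorem simply_connected_by_two_open_sets:
  assumes A: "openin S A" and B: "openin S B" and cover: "A \<union> B = topspace S" and e: "e \<in> topspace S"
    and paths: "\<And>y. y \<in> topspace S \<Longrightarrow> \<exists>c. pathin S c \<and> c 0 = e \<and> c 1 = y \<and>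
          (y \<in> A \<longrightarrow> c ` {0..1} \<subseteq> A) \<and> (y \<in> B \<longrightarrow> c ` {0..1} \<subseteq> B)"
    and loops: "\<And>p. pathin S p \<Longrightarrow> p 0 = p 1 \<Longrightarrow> p ` {0..1} \<subseteq> A \<or> p ` {0..1} \<subseteq> B
          \<Longrightarrow> path_homotopic S (p 0) (p 0) p (\<lambda>_. p 0)"
  shows "simply_connected_space S"
proof -
  have "\<forall>y\<in>topspace S. \<exists>c. continuous_map (top_of_set {0..1::real}) S c \<and> c 0 = e \<and> c 1 = y \<and>
          (y \<in> A \<longrightarrow> c ` {0..1} \<subseteq> A) \<and> (y \<in> B \<longrightarrow> c ` {0..1} \<subseteq> B)"
    by (intro ballI) (use paths[unfolded pathin_def] in blast)
  from bchoice[OF this] obtain c where "\<forall>y\<in>topspace S.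
          continuous_map (top_of_set {0..1::real}) S (c y) \<and> c y 0 = e \<and> c y 1 = y \<and>
          (y \<in> A \<longrightarrow> c y ` {0..1} \<subseteq> A) \<and> (y \<in> B \<longrightarrow> c y ` {0..1} \<subseteq> B)" ..
  note c = this[rule_format]
  have same: "path_homotopic S (p 0) (p 1) p q"
    if p: "continuous_map (top_of_set {0..1}) S p" and q: "continuous_map (top_of_set {0..1}) S q"
      and eq: "p 0 = q 0" "p 1 = q 1"
      and W: "W = A \<or> W = B" "p ` {0..1} \<subseteq> W" "q ` {0..1} \<subseteq> W" for p q W
  proof -
    let ?l = "pjoin p (\<lambda>s. q (1 - s))"
    have "continuous_map (top_of_set {0..1}) S (\<lambda>s. q (1 - s))"
      by (rule continuous_map_compose[OF _ q, unfolded o_def]) (auto intro!: continuous_intros)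
    then have "pathin S ?l"
      unfolding pathin_def using p eq by (intro continuous_map_pjoin) auto
    moreover have "?l ` {0..1} \<subseteq> W"
      using W(2,3) by (auto simp: pjoin_def image_subset_iff)
    ultimately have "path_homotopic S (?l 0) (?l 0) ?l (\<lambda>_. ?l 0)"
      using W(1) eq by (intro loops) (auto simp: pjoin_def)
    then show ?thesis
      by (intro path_homotopic_if_loop_null p q eq) (simp add: pjoin_def)
  qed
  have null: "path_homotopic S (p 0) (p 0) p (\<lambda>_. p 0)"
    if p: "continuous_map (top_of_set {0..1}) S p" and p01: "p 0 = p 1" for p
  proof -
    have pS: "p s \<in> topspace S" if "0 \<le> s" "s \<le> 1" for s
      using continuous_map_image_subset_topspace[OF p] that by auto
    define seg where "seg a b = (\<lambda>s. p (a + (b - a) * s))" for a b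
    have lin: "0 \<le> k * s" "k * s \<le> k" if "0 \<le> k" "0 \<le> s" "s \<le> 1" for k s :: real
      using that mult_left_le[of s k] by auto
    have bd: "0 \<le> a + (b - a) * s \<and> a + (b - a) * s \<le> 1"
      if "0 \<le> a" "a \<le> b" "b \<le> 1" "0 \<le> s" "s \<le> 1" for a b s :: real
      using lin[of "b - a" s] that by auto
    have seg: "continuous_map (top_of_set {0..1}) S (seg a b)" if "0 \<le> a" "a \<le> b" "b \<le> 1" for a b
      unfolding seg_def by (rule continuous_map_compose[OF _ p, unfolded o_def])
        (use bd that in \<open>auto intro!: continuous_intros\<close>)
    \<comment> \<open>Transporting the chosen path \<open>c (p a)\<close> along \<open>p\<close> gives the chosen path \<open>c (p b)\<close>.\<close>
    define Q where "Q a b \<longleftrightarrow> (0 \<le> a \<and> b \<le> 1 \<longrightarrow>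
        path_homotopic S e (p b) (pjoin (c (p a)) (seg a b)) (c (p b)))" for a b
    have "Q 0 1"
    proof (rule Bolzano)
      fix x y z :: real
      assume Q: "Q x y" "Q y z" and xyz: "x \<le> y" "y \<le> z"
      show "Q x z"
        unfolding Q_def
      proof (intro impI; elim conjE)
        assume bds: "0 \<le> x" "z \<le> 1"
        let ?c = "c (p x)"
        note cx = c[OF pS[of x]]
        \<comment> \<open>The path \<open>?c\<close> followed by \<open>p\<close> from
          \<open>x\<close> to \<open>z\<close>, on a single interval. Both bracketings of the
          threefold concatenation are reparametrisations of \<open>g\<close>, so associativity
          becomes an instance of \<open>path_homotopic_reparam\<close>.\<close>
        define g where "g t = (if t \<le> 1 then ?c t else p (x + t - 1))" for t
        let ?K = "{0..1 + (z - x)}"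
        have g: "continuous_map (top_of_set ?K) S g"
          unfolding g_def
        proof (rule continuous_map_cases_le)
          show "continuous_map (subtopology (top_of_set ?K) {x \<in> topspace (top_of_set ?K). x \<le> 1}) S ?c"
          proof -
            have "{0..1 + (z - x)} \<inter> {t \<in> {0..1 + (z - x)}. t \<le> 1} = {0..1}"
              using xyz by auto
            then show ?thesis using cx bds xyz by (simp add: subtopology_subtopology)
          qed
          show "continuous_map (subtopology (top_of_set ?K) {x \<in> topspace (top_of_set ?K). 1 \<le> x}) S (\<lambda>t. p (x + t - 1))"
            by (rule continuous_map_compose[OF _ p, unfolded o_def])
              (use bds xyz in \<open>auto simp: subtopology_subtopology intro!: continuous_intros\<close>)
        qed (use cx xyz bds in auto)
        have gl: "g t = ?c t" if "t \<le> 1" for t using that by (simp add: g_def)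
        have gr: "g (1 + t) = p (x + t)" if "0 \<le> t" for t using that cx bds xyz by (auto simp: g_def)
        let ?r = "pjoin (\<lambda>s. s) (\<lambda>s. 1 + (z - x) * s)"
        let ?r' = "pjoin (pjoin (\<lambda>s. s) (\<lambda>s. 1 + (y - x) * s)) (\<lambda>s. 1 + (y - x) + (z - y) * s)"
        have "path_homotopic S e (p z) (pjoin ?c (seg x z)) (pjoin (pjoin ?c (seg x y)) (seg y z))"
        proof (rule path_homotopic_reparam[OF g, where r = ?r and r' = ?r'])
          show "continuous_on {0..1} ?r"
            using continuous_map_pjoin[of euclideanreal "\<lambda>s. s" "\<lambda>s. 1 + (z - x) * s"]
            by (simp add: continuous_on_add continuous_on_mult_left)
          show "continuous_on {0..1} ?r'"
            using continuous_map_pjoin[of euclideanreal "\<lambda>s. s" "\<lambda>s. 1 + (y - x) * s"]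
              continuous_map_pjoin[of euclideanreal "pjoin (\<lambda>s. s) (\<lambda>s. 1 + (y - x) * s)"
                "\<lambda>s. 1 + (y - x) + (z - y) * s"]
            by (simp add: continuous_on_add continuous_on_mult_left pjoin_def)
          show "?r ` {0..1} \<subseteq> ?K"
            using lin[of "z - x"] xyz by (intro pjoin_image_subset) auto
          show "?r' ` {0..1} \<subseteq> ?K"
          proof (intro pjoin_image_subset)
            show "(\<lambda>s. 1 + (y - x) * s) ` {0..1} \<subseteq> ?K"
              using lin[of "y - x"] xyz by (force simp: image_subset_iff)
            show "(\<lambda>s. 1 + (y - x) + (z - y) * s) ` {0..1} \<subseteq> ?K"
              using lin[of "z - y"] xyz by (force simp: image_subset_iff)
          qed (use xyz in auto)
          show "pjoin ?c (seg x z) s = g (?r s)" if s: "0 \<le> s" "s \<le> 1" for s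
          proof (cases "s \<le> 1/2")
            case True
            then show ?thesis by (simp add: pjoin_def gl)
          next
            case False
            then show ?thesis
              using gr[of "(z - x) * (2 * s - 1)"] lin(1)[of "z - x" "2 * s - 1"] s xyz
              by (simp add: pjoin_def seg_def)
          qed
          show "pjoin (pjoin ?c (seg x y)) (seg y z) s = g (?r' s)" if s: "0 \<le> s" "s \<le> 1" for s
          proof -
            consider "s \<le> 1/4" | "1/4 < s" "s \<le> 1/2" | "1/2 < s" by linarith
            then show ?thesis
            proof cases
              case 1
              then show ?thesis by (simp add: pjoin_def gl)
            next
              case 2
              then show ?thesis
                using gr[of "(y - x) * (4 * s - 1)"] lin(1)[of "y - x" "4 * s - 1"] s xyz
                by (simp add: pjoin_def seg_def)
            next
              case 3
              then show ?thesis
                using gr[of "(y - x) + (z - y) * (2 * s - 1)"] lin(1)[of "z - y" "2 * s - 1"] s xyz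
                by (simp add: pjoin_def seg_def add.assoc)
            qed
          qed
          show "p z = g (?r 1)"
            using gr[of "z - x"] xyz by (simp add: pjoin_def)
        qed (use cx gl xyz bds in \<open>simp_all add: pjoin_def\<close>)
        also have "path_homotopic S e (p z) \<dots> (pjoin (c (p y)) (seg y z))"
          using Q bds xyz seg[of y z]
          by (intro path_homotopic_pjoin) (auto simp: Q_def path_homotopic_def seg_def)
        also have "path_homotopic S e (p z) \<dots> (c (p z))"
          using Q bds xyz by (auto simp: Q_def)
        finally show "path_homotopic S e (p z) (pjoin ?c (seg x z)) (c (p z))" .
      qed
    next
      fix x :: real
      assume x: "0 \<le> x" "x \<le> 1"
      obtain W where W: "W = A \<or> W = B" "p x \<in> W" "openin S W"
        using pS[OF x] cover A B by blast
      have "openin (top_of_set {0..1}) {s \<in> {0..1}. p s \<in> W}"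
        using openin_continuous_map_preimage[OF p W(3)] by simp
      then obtain d where d: "d > 0" "\<And>s. s \<in> {0..1} \<Longrightarrow> \<bar>s - x\<bar> < d \<Longrightarrow> p s \<in> W"
        using x W(2) unfolding openin_euclidean_subtopology_iff by (auto simp: dist_real_def)
      show "\<exists>d>0. \<forall>a b. a \<le> x \<and> x \<le> b \<and> b - a < d \<longrightarrow> Q a b"
      proof (intro exI[of _ d] conjI allI impI d(1))
        fix a b assume ab: "a \<le> x \<and> x \<le> b \<and> b - a < d"
        show "Q a b"
          unfolding Q_def
        proof (intro impI; elim conjE)
          assume bds: "0 \<le> a" "b \<le> 1"
          have segW: "seg a b s \<in> W" if s: "0 \<le> s" "s \<le> 1" for s
          proof -
            have "0 \<le> b - a" using ab by simp
            then have "\<bar>a + (b - a) * s - x\<bar> < d"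
              using lin[of "b - a" s] s ab by linarith
            then show ?thesis
              unfolding seg_def using bd[of a b s] s ab bds by (intro d(2)) auto
          qed
          have pW: "p a \<in> W" "p b \<in> W" using d(2) ab bds by auto
          have ca: "c (p a) ` {0..1} \<subseteq> W" and cb: "c (p b) ` {0..1} \<subseteq> W"
            using c[OF pS, of a] c[OF pS, of b] pW W(1) ab bds by auto
          have ends: "pjoin (c (p a)) (seg a b) 0 = e" "pjoin (c (p a)) (seg a b) 1 = p b"
            "c (p b) 0 = e" "c (p b) 1 = p b"
            using c[OF pS, of a] c[OF pS, of b] ab bds by (auto simp: pjoin_def seg_def)
          have "path_homotopic S (pjoin (c (p a)) (seg a b) 0) (pjoin (c (p a)) (seg a b) 1)
                  (pjoin (c (p a)) (seg a b)) (c (p b))"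
          proof (rule same[OF _ _ _ _ W(1)])
            show "continuous_map (top_of_set {0..1}) S (pjoin (c (p a)) (seg a b))"
              using c[OF pS, of a] ab bds seg by (intro continuous_map_pjoin) (auto simp: seg_def)
            show "pjoin (c (p a)) (seg a b) ` {0..1} \<subseteq> W"
              using ca segW by (auto simp: pjoin_def image_subset_iff)
          qed (use c[OF pS, of b] cb ab bds ends in auto)
          then show "path_homotopic S e (p b) (pjoin (c (p a)) (seg a b)) (c (p b))"
            unfolding ends .
        qed
      qed
    qed simp
    moreover have "seg 0 1 = p" by (simp add: seg_def)
    ultimately have absorb: "path_homotopic S e (p 0) (pjoin (c (p 0)) p) (c (p 0))"
      unfolding Q_def by (simp add: p01)
    have c0: "continuous_map (top_of_set {0..1}) S (c (p 0))" "c (p 0) 0 = e" "c (p 0) 1 = p 0"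
      using c[OF pS[of 0]] by auto
    show ?thesis
      by (rule loop_null_if_absorbed[OF c0(1), of p, unfolded c0])
        (use absorb p01 in simp_all)
  qed
  have "path_connected_space S"
    unfolding path_connected_space_def
  proof (intro ballI)
    fix x y assume xy: "x \<in> topspace S" "y \<in> topspace S"
    have "continuous_map (top_of_set {0..1}) S (\<lambda>s. c x (1 - s))"
      by (rule continuous_map_compose[of _ "top_of_set {0..1}", unfolded o_def])
        (use c[OF xy(1)] in \<open>auto intro!: continuous_intros\<close>)
    then have "pathin S (pjoin (\<lambda>s. c x (1 - s)) (c y))"
      unfolding pathin_def using c[OF xy(1)] c[OF xy(2)] by (intro continuous_map_pjoin) auto
    then show "\<exists>g. pathin S g \<and> g 0 = x \<and> g 1 = y"
      using c[OF xy(1)] c[OF xy(2)] by (rule_tac x = "pjoin (\<lambda>s. c x (1 - s)) (c y)" in exI) (auto simp: pjoin_def)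
  qed
  moreover have "homotopic_with (\<lambda>r. r 0 = a \<and> r 1 = a) (top_of_set {0..1}) S p (\<lambda>_. a)"
    if "pathin S p \<and> p 0 = a \<and> p 1 = a" for a p
    using null[of p] that unfolding pathin_def path_homotopic_def by metis
  ultimately show ?thesis
    using e unfolding simply_connected_space_def by blast
qed

subsection \<open>Lifting paths of multisets\<close>

text \<open>Lower semicontinuity of the number of points in each open set. For multisets of constant size in a
  Hausdorff space this is continuity into the symmetric power.\<close>

definition mset_continuous :: "'a topology \<Rightarrow> (real \<Rightarrow> 'a multiset) \<Rightarrow> bool" where
  "mset_continuous Y f \<longleftrightarrow>
     (\<forall>V k. openin Y V \<longrightarrow> open {s. k \<le> size (filter_mset (\<lambda>y. y \<in> V) (f s))})"

lemma mset_continuous_compose: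
  assumes "mset_continuous Y f" "continuous_on UNIV \<phi>"
  shows "mset_continuous Y (\<lambda>s. f (\<phi> s))"
  unfolding mset_continuous_def
proof (intro allI impI)
  fix V k assume "openin Y V"
  then have "open {s. k \<le> size (filter_mset (\<lambda>y. y \<in> V) (f s))}"
    using assms(1) by (simp add: mset_continuous_def)
  from open_vimage[OF this assms(2)]
  show "open {s. k \<le> size (filter_mset (\<lambda>y. y \<in> V) (f (\<phi> s)))}"
    by (simp add: vimage_def)
qed

lemma mset_continuousD:
  assumes "mset_continuous Y f" "openin Y V" "k \<le> size (filter_mset (\<lambda>y. y \<in> V) (f s1))"
  shows "\<exists>d>0. \<forall>s. \<bar>s - s1\<bar> < d \<longrightarrow> k \<le> size (filter_mset (\<lambda>y. y \<in> V) (f s))"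
proof -
  have "open {s. k \<le> size (filter_mset (\<lambda>y. y \<in> V) (f s))}"
    using assms by (simp add: mset_continuous_def)
  then show ?thesis
    using assms(3) unfolding open_dist by (auto simp: dist_real_def)
qed

lemma size_filter_mset_disjoint:
  assumes "V \<inter> V' = {}"
  shows "size (filter_mset (\<lambda>y. y \<in> V) M) + size (filter_mset (\<lambda>y. y \<in> V') M) \<le> size M"
    and "size M \<le> size (filter_mset (\<lambda>y. y \<in> V) M) + size (filter_mset (\<lambda>y. y \<in> V') M)
          \<Longrightarrow> set_mset M \<subseteq> V \<union> V'"
    and "set_mset M \<subseteq> V \<union> V'
          \<Longrightarrow> size M = size (filter_mset (\<lambda>y. y \<in> V) M) + size (filter_mset (\<lambda>y. y \<in> V') M)"
proof -
  have eq: "size (filter_mset (\<lambda>y. y \<in> V) M) + size (filter_mset (\<lambda>y. y \<in> V') M)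
      = size (filter_mset (\<lambda>y. y \<in> V \<union> V') M)"
    using assms by (induction M) auto
  show "size (filter_mset (\<lambda>y. y \<in> V) M) + size (filter_mset (\<lambda>y. y \<in> V') M) \<le> size M"
    unfolding eq by (rule size_filter_mset_lesseq)
  show "set_mset M \<subseteq> V \<union> V'"
    if "size M \<le> size (filter_mset (\<lambda>y. y \<in> V) M) + size (filter_mset (\<lambda>y. y \<in> V') M)"
  proof (rule ccontr)
    assume "\<not> ?thesis"
    then obtain x where x: "x \<in># M" "x \<notin> V \<union> V'" by blast
    then have "size (filter_mset (\<lambda>y. y \<notin> V \<union> V') M) > 0"
      by (auto simp: nonempty_has_size[symmetric] filter_mset_eq_mempty_iff)
    moreover have "size M = size (filter_mset (\<lambda>y. y \<in> V \<union> V') M) + size (filter_mset (\<lambda>y. y \<notin> V \<union> V') M)"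
      by (metis multiset_partition size_union)
    ultimately show False using that eq by linarith
  qed
  show "size M = size (filter_mset (\<lambda>y. y \<in> V) M) + size (filter_mset (\<lambda>y. y \<in> V') M)"
    if "set_mset M \<subseteq> V \<union> V'"
    unfolding eq using that by (induction M) auto
qed

text \<open>Near \<open>s1\<close> neither count can drop, by lower semicontinuity. Their sum is at
  most \<open>n\<close> and equals \<open>n\<close> at \<open>s1\<close>, so neither can grow and no
  point lies outside \<open>V \<union> V'\<close>.\<close>

lemma mset_continuous_split:
  assumes f: "mset_continuous Y f" "\<And>s. size (f s) = n"
    and V: "openin Y V" "openin Y V'" "V \<inter> V' = {}" and s1: "set_mset (f s1) \<subseteq> V \<union> V'"
  obtains d where "d > 0"
    "\<And>s. \<bar>s - s1\<bar> < d \<Longrightarrow> set_mset (f s) \<subseteq> V \<union> V'"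
    "\<And>s. \<bar>s - s1\<bar> < d \<Longrightarrow>
       size (filter_mset (\<lambda>y. y \<in> V) (f s)) = size (filter_mset (\<lambda>y. y \<in> V) (f s1))"
    "\<And>s. \<bar>s - s1\<bar> < d \<Longrightarrow>
       size (filter_mset (\<lambda>y. y \<in> V') (f s)) = size (filter_mset (\<lambda>y. y \<in> V') (f s1))"
proof -
  let ?c = "\<lambda>V s. size (filter_mset (\<lambda>y. y \<in> V) (f s))"
  obtain d where d: "d > 0" "\<And>s. \<bar>s - s1\<bar> < d \<Longrightarrow> ?c V s1 \<le> ?c V s"
    using mset_continuousD[OF f(1) V(1) order_refl] by metis
  obtain d' where d': "d' > 0" "\<And>s. \<bar>s - s1\<bar> < d' \<Longrightarrow> ?c V' s1 \<le> ?c V' s"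
    using mset_continuousD[OF f(1) V(2) order_refl] by metis
  have "?c V s1 + ?c V' s1 = n"
    using size_filter_mset_disjoint(3)[OF V(3) s1] f(2) by simp
  moreover have "?c V s + ?c V' s \<le> n" for s
    using size_filter_mset_disjoint(1)[OF V(3), of "f s"] f(2) by simp
  ultimately have eq: "?c V s = ?c V s1" "?c V' s = ?c V' s1" "?c V s + ?c V' s = n"
    if "\<bar>s - s1\<bar> < min d d'" for s
  proof -
    have "?c V s1 \<le> ?c V s" "?c V' s1 \<le> ?c V' s" using d(2)[of s] d'(2)[of s] that by auto
    moreover have "?c V s + ?c V' s \<le> n" "?c V s1 + ?c V' s1 = n" by fact+
    ultimately show "?c V s = ?c V s1" "?c V' s = ?c V' s1" "?c V s + ?c V' s = n" by linarith+
  qed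
  show thesis
  proof (rule that[of "min d d'"])
    show "min d d' > 0" using d(1) d'(1) by simp
    show "set_mset (f s) \<subseteq> V \<union> V'" if "\<bar>s - s1\<bar> < min d d'" for s
      by (rule size_filter_mset_disjoint(2)[OF V(3)]) (use eq(3)[OF that] f(2)[of s] in simp)
  qed (fact eq)+
qed

lemma separate_point_from_finite:
  assumes "Hausdorff_space Y" "finite F" "F \<subseteq> topspace Y" "v \<in> topspace Y" "v \<notin> F"
  obtains V V' where "openin Y V" "openin Y V'" "v \<in> V" "F \<subseteq> V'" "V \<inter> V' = {}"
proof -
  have "compactin Y {v}" "compactin Y F" "disjnt {v} F"
    using assms by (auto simp: finite_imp_compactin_eq disjnt_def)
  then show thesis
    using assms(1) that unfolding Hausdorff_space_compact_sets disjnt_def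
    by (metis insert_subset)
qed

section \<open>Continuous selections on intervals and their gluing\<close>

definition selects_on :: "'a topology \<Rightarrow> (real \<Rightarrow> 'a multiset) \<Rightarrow> real set \<Rightarrow> (real \<Rightarrow> 'a) \<Rightarrow> bool" where
  "selects_on Y f K g \<longleftrightarrow> continuous_map (top_of_set K) Y g \<and> (\<forall>s\<in>K. g s \<in># f s)"

text \<open>Prescribing the value at an arbitrary parameter is what makes gluing possible: at a
  common end point the second selection is asked to pass through the value of the first.\<close>

definition selectable :: "'a topology \<Rightarrow> (real \<Rightarrow> 'a multiset) \<Rightarrow> real set \<Rightarrow> bool" where
  "selectable Y f K \<longleftrightarrow> (\<forall>s\<in>K. \<forall>v. v \<in># f s \<longrightarrow> (\<exists>g. selects_on Y f K g \<and> g s = v))"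

lemma selectableD:
  "selectable Y f K \<Longrightarrow> s \<in> K \<Longrightarrow> v \<in># f s \<Longrightarrow> \<exists>g. selects_on Y f K g \<and> g s = v"
  unfolding selectable_def by blast

lemma selects_onD: "selects_on Y f K g \<Longrightarrow> s \<in> K \<Longrightarrow> g s \<in># f s"
  unfolding selects_on_def by blast

lemma selects_on_glue:
  assumes g: "selects_on Y f {a..b} g" and h: "selects_on Y f {b..c} h" and eq: "g b = h b"
    and "a \<le> b" "b \<le> c"
  shows "selects_on Y f {a..c} (\<lambda>s. if s \<le> b then g s else h s)"
proof -
  have "{a..c} \<inter> {x \<in> {a..c}. x \<le> b} = {a..b}" "{a..c} \<inter> {x \<in> {a..c}. b \<le> x} = {b..c}"
    using assms by auto
  then have "continuous_map (top_of_set {a..c}) Y (\<lambda>s. if s \<le> b then g s else h s)"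
    using g h eq by (intro continuous_map_cases_le) (auto simp: selects_on_def subtopology_subtopology)
  then show ?thesis
    using g h by (auto simp: selects_on_def)
qed

lemma selects_on_extend:
  assumes g: "selects_on Y f {a..b} g" and ab: "a' \<le> a" "a \<le> b" "b \<le> b'"
    and sel: "\<And>a b. a \<le> b \<Longrightarrow> selectable Y f {a..b}"
  obtains g' where "selects_on Y f {a'..b'} g'" "\<And>s. s \<in> {a..b} \<Longrightarrow> g' s = g s"
proof -
  obtain h where h: "selects_on Y f {b..b'} h" "h b = g b"
    using selectableD[OF sel[of b b'], of b "g b"] selects_onD[OF g, of b] ab by auto
  obtain k where k: "selects_on Y f {a'..a} k" "k a = g a"
    using selectableD[OF sel[of a' a], of a "g a"] selects_onD[OF g, of a] ab by auto
  let ?g1 = "\<lambda>s. if s \<le> b then g s else h s"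
  have "selects_on Y f {a..b'} ?g1"
    by (rule selects_on_glue) (use g h ab in auto)
  then have "selects_on Y f {a'..b'} (\<lambda>s. if s \<le> a then k s else ?g1 s)"
    by (rule selects_on_glue[OF k(1)]) (use k ab in auto)
  then show thesis
    by (rule that) (use k in auto)
qed

lemma selectable_trans:
  assumes "selectable Y f {a..b}" "selectable Y f {b..c}" "a \<le> b" "b \<le> c"
  shows "selectable Y f {a..c}"
  unfolding selectable_def
proof (intro ballI allI impI)
  fix s v assume s: "s \<in> {a..c}" "v \<in># f s"
  show "\<exists>g. selects_on Y f {a..c} g \<and> g s = v"
  proof (cases "s \<le> b")
    case True
    then obtain g where g: "selects_on Y f {a..b} g" "g s = v"
      using selectableD[OF assms(1), of s v] s by auto
    obtain h where "selects_on Y f {b..c} h" "h b = g b"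
      using selectableD[OF assms(2), of b "g b"] selects_onD[OF g(1), of b] assms(3,4) by auto
    from selects_on_glue[OF g(1) this(1) this(2)[symmetric] assms(3,4)] True g(2) show ?thesis
      by (rule_tac exI) auto
  next
    case False
    then obtain h where h: "selects_on Y f {b..c} h" "h s = v"
      using selectableD[OF assms(2), of s v] s by auto
    obtain g where "selects_on Y f {a..b} g" "g b = h b"
      using selectableD[OF assms(1), of b "h b"] selects_onD[OF h(1), of b] assms(3,4) by auto
    from selects_on_glue[OF this(1) h(1) this(2) assms(3,4)] False h(2) show ?thesis
      by (rule_tac exI) auto
  qed
qed

text \<open>The line is exhausted by the intervals of radius \<open>k\<close> around
  \<open>s0\<close>. Dependent choice extends a selection from each interval to the next, and the
  agreeing selections are pasted.\<close>

lemma selects_on_UNIV_if_compact: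
  assumes sel: "\<And>a b. a \<le> b \<Longrightarrow> selectable Y f {a..b}" and v: "v \<in># f s0"
  shows "\<exists>g. selects_on Y f UNIV g \<and> g s0 = v"
proof -
  let ?K = "\<lambda>k. {s0 - real k..s0 + real k}"
  have "\<exists>G. \<forall>k. (selects_on Y f (?K k) (G k) \<and> G k s0 = v) \<and> (\<forall>s\<in>?K k. G (Suc k) s = G k s)"
  proof (rule dependent_nat_choice)
    show "\<exists>g. selects_on Y f (?K 0) g \<and> g s0 = v"
      using sel[of s0 s0] v unfolding selectable_def by auto
  next
    fix g k assume g: "selects_on Y f (?K k) g \<and> g s0 = v"
    obtain g' where "selects_on Y f (?K (Suc k)) g'" "\<And>s. s \<in> ?K k \<Longrightarrow> g' s = g s"
      by (rule selects_on_extend[of Y f "s0 - real k" "s0 + real k" g "s0 - real (Suc k)" "s0 + real (Suc k)"])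
        (use g sel in auto)
    then show "\<exists>g'. (selects_on Y f (?K (Suc k)) g' \<and> g' s0 = v) \<and> (\<forall>s\<in>?K k. g' s = g s)"
      using g by (intro exI[of _ g']) auto
  qed
  then obtain G where G: "\<And>k. selects_on Y f (?K k) (G k)" "\<And>k. G k s0 = v"
    "\<And>k s. s \<in> ?K k \<Longrightarrow> G (Suc k) s = G k s" by metis
  have stable: "G (k + j) s = G k s" if "s \<in> ?K k" for k j s
    by (induction j) (use that G(3) in auto)
  then have agree: "G i s = G j s" if "s \<in> ?K i" "s \<in> ?K j" for i j s
    using that by (metis le_add_diff_inverse linear)
  \<comment> \<open>The added 1 makes the radius exceed the distance strictly, so \<open>s\<close>
    lies in the open interval that the pasting lemma requires.\<close>
  let ?n = "\<lambda>s. nat \<lceil>\<bar>s - s0\<bar>\<rceil> + 1"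
  have n: "\<bar>s - s0\<bar> < real (?n s)" for s
    by linarith
  let ?g = "\<lambda>s. G (?n s) s"
  have "continuous_map euclideanreal Y ?g"
  proof (rule pasting_lemma[where I = UNIV and T = "\<lambda>k. {s0 - real k<..<s0 + real k}" and f = G])
    show "continuous_map (subtopology euclideanreal {s0 - real k<..<s0 + real k}) Y (G k)" for k
      using G(1)[of k] unfolding selects_on_def
      by (auto elim!: continuous_map_from_subtopology_mono)
    show "\<exists>j. j \<in> UNIV \<and> s \<in> {s0 - real j<..<s0 + real j} \<and> ?g s = G j s" for s
      using n[of s] by (intro exI[of _ "?n s"]) (auto simp: abs_less_iff)
  qed (auto intro!: agree)
  moreover have "?g s \<in># f s" for s
    using G(1)[of "?n s"] n[of s] unfolding selects_on_def by (auto simp: abs_less_iff)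
  ultimately show ?thesis
    using G(2) by (intro exI[of _ ?g]) (auto simp: selects_on_def)
qed

text \<open>Lets a component of an open set of parameters be treated as the whole line, which
  compact intervals exhaust. An open set contains no end point of its own, which leaves only the
  line, open rays and bounded open intervals.\<close>

lemma open_connected_real_homeomorphic_UNIV:
  fixes J :: "real set"
  assumes "open J" "connected J" "J \<noteq> {}"
  shows "(UNIV :: real set) homeomorphic J"
proof -
  have ray: "{a<..} homeomorphic (UNIV :: real set)" for a :: real
  proof (rule homeomorphicI[of "\<lambda>x. ln (x - a)" _ _ "\<lambda>y. a + exp y"])
    show "range (\<lambda>y. a + exp y) = {a<..}"
    proof (intro equalityI subsetI)
      fix x assume "x \<in> {a<..}"
      then have "x = a + exp (ln (x - a))" by simp
      then show "x \<in> range (\<lambda>y. a + exp y)" by blast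
    qed auto
    show "(\<lambda>x. ln (x - a)) ` {a<..} = UNIV"
    proof (intro equalityI subsetI)
      fix y :: real
      show "y \<in> (\<lambda>x. ln (x - a)) ` {a<..}"
        by (rule image_eqI[of _ _ "a + exp y"]) auto
    qed auto
  qed (auto intro!: continuous_intros)
  have "bij_betw uminus {..<b} {- b<..}" for b :: real
    by (rule bij_betwI[of _ _ _ uminus]) auto
  then have ray': "{..<b} homeomorphic {- b<..}" for b :: real
    by (intro homeomorphicI[of uminus _ _ uminus]) (auto simp: bij_betw_def intro!: continuous_intros)
  obtain a b where cases: "J = {} \<or> J = UNIV \<or> J = {..<b} \<or> J = {..b} \<or> J = {a<..} \<or> J = {a..} \<or>
      J = {a<..<b} \<or> J = {a<..b} \<or> J = {a..<b} \<or> J = {a..b}"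
    using interval_cases[of J] assms(2) unfolding connected_iff_interval by metis
  have "\<exists>y\<in>J. x < y" and "\<exists>y\<in>J. y < x" if x: "x \<in> J" for x
  proof -
    obtain d where "d > 0" "\<And>y. \<bar>y - x\<bar> < d \<Longrightarrow> y \<in> J"
      using assms(1) x unfolding open_dist dist_real_def by auto
    then have "x + d / 2 \<in> J" "x - d / 2 \<in> J" "d > 0" by auto
    then show "\<exists>y\<in>J. x < y" "\<exists>y\<in>J. y < x"
      by (force intro: bexI[of _ "x + d / 2"], force intro: bexI[of _ "x - d / 2"])
  qed
  then have na: "a \<notin> J \<or> (\<exists>y\<in>J. y < a)" and nb: "b \<notin> J \<or> (\<exists>y\<in>J. b < y)"
    by blast+
  have "J = UNIV \<or> J = {..<b} \<or> J = {a<..} \<or> J = {a<..<b} \<and> a < b"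
    using cases
  proof (elim disjE)
    assume "J = {..b}"
    then show ?thesis using nb by simp
  next
    assume "J = {a..}"
    then show ?thesis using na by simp
  next
    assume J: "J = {a<..b}"
    then have "a < b" using assms(3) by auto
    then show ?thesis using nb J by simp
  next
    assume J: "J = {a..<b}"
    then have "a < b" using assms(3) by auto
    then show ?thesis using na J by simp
  next
    assume J: "J = {a..b}"
    then have "a \<le> b" using assms(3) by auto
    then show ?thesis using na J by simp
  next
    assume J: "J = {a<..<b}"
    then have "a < b" using assms(3) by auto
    then show ?thesis using J by simp
  qed (use assms(3) in simp_all)
  then have "J homeomorphic (UNIV :: real set)"
    using ray homeomorphic_trans[OF ray' ray] homeomorphic_open_interval_UNIV[of a b] homeomorphic_refl by auto
  then show ?thesis using homeomorphic_sym by blast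
qed

text \<open>Two distinct points of \<open>f s1\<close> are separated by disjoint open sets. Near
  \<open>s1\<close> the multiset splits into the parts in these two sets, both nonempty and of
  constant size below \<open>n\<close>. A prescribed point lies in one part, from which the
  induction hypothesis selects.\<close>

lemma locally_selectable:
  assumes Y: "Hausdorff_space Y" and n: "n \<ge> 1"
    and IH: "\<forall>m<n. \<forall>h v s0. mset_continuous Y h \<longrightarrow> (\<forall>s. size (h s) = m) \<longrightarrow>
       (\<forall>s. set_mset (h s) \<subseteq> topspace Y) \<longrightarrow> v \<in># h s0 \<longrightarrow>
       (\<exists>g. continuous_map euclideanreal Y g \<and> (\<forall>s. g s \<in># h s) \<and> g s0 = v)"
    and f: "mset_continuous Y f" "\<And>s. size (f s) = n" "\<And>s. set_mset (f s) \<subseteq> topspace Y"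
    and s1: "\<And>y. f s1 \<noteq> replicate_mset n y"
  shows "\<exists>d>0. (\<forall>s. \<bar>s - s1\<bar> < d \<longrightarrow> (\<forall>y. f s \<noteq> replicate_mset n y)) \<and>
      (\<forall>a b. s1 - d < a \<and> b < s1 + d \<longrightarrow> selectable Y f {a..b})"
proof -
  let ?c = "\<lambda>V s. size (filter_mset (\<lambda>y. y \<in> V) (f s))"
  obtain w where w: "w \<in># f s1"
    using f(2)[of s1] n by (metis multiset_nonemptyE not_one_le_zero size_empty)
  obtain V V' where V: "openin Y V" "openin Y V'" "w \<in> V" "set_mset (f s1) - {w} \<subseteq> V'" "V \<inter> V' = {}"
    using separate_point_from_finite[OF Y, of "set_mset (f s1) - {w}" w] f(3)[of s1] w by blast
  have sub: "set_mset (f s1) \<subseteq> V \<union> V'" using V by blast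
  obtain d where d: "d > 0" "\<And>s. \<bar>s - s1\<bar> < d \<Longrightarrow> set_mset (f s) \<subseteq> V \<union> V'"
    "\<And>s. \<bar>s - s1\<bar> < d \<Longrightarrow> ?c V s = ?c V s1" "\<And>s. \<bar>s - s1\<bar> < d \<Longrightarrow> ?c V' s = ?c V' s1"
    using mset_continuous_split[OF f(1,2) V(1,2,5) sub] by blast
  have ne: "\<exists>w'. w' \<in># f s1 \<and> w' \<noteq> w"
  proof (rule ccontr)
    assume "\<not> ?thesis"
    then have "f s1 = replicate_mset n w"
      using f(2)[of s1] by (metis set_mset_subset_singletonD singleton_iff subsetI)
    then show False using s1 by auto
  qed
  have pos: "?c V s1 > 0" "?c V' s1 > 0"
    using w ne V by (auto simp: nonempty_has_size[symmetric] filter_mset_eq_mempty_iff)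
  have sum: "?c V s1 + ?c V' s1 = n"
    using size_filter_mset_disjoint(3)[OF V(5) sub] f(2) by simp
  have "f s \<noteq> replicate_mset n y" if "\<bar>s - s1\<bar> < d" for s y
  proof
    assume "f s = replicate_mset n y"
    moreover have "?c V s > 0" "?c V' s > 0" using d(3,4)[OF that] pos by simp_all
    ultimately have "y \<in> V" "y \<in> V'"
      by (auto simp: nonempty_has_size[symmetric] filter_mset_eq_mempty_iff split: if_splits)
    then show False using V(5) by blast
  qed
  moreover have "selectable Y f {a..b}" if ab: "s1 - d < a" "b < s1 + d" for a b
    unfolding selectable_def
  proof (intro ballI allI impI)
    fix s v assume s: "s \<in> {a..b}" and v: "v \<in># f s"
    have near: "\<bar>t - s1\<bar> < d" if "t \<in> {a..b}" for t using that ab by auto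
    obtain W where W: "W = V \<or> W = V'" "v \<in> W"
      using d(2)[OF near[OF s]] v by auto
    then have Wo: "openin Y W" using V by auto
    have Wn: "?c W s1 < n" using W pos sum by auto
    have Wc: "?c W t = ?c W s1" if "t \<in> {a..b}" for t
      using d(3,4)[OF near[OF that]] W by auto
    \<comment> \<open>The induction hypothesis speaks of multisets over the whole line. Clamping to
      \<open>{a..b}\<close> extends the part in \<open>W\<close> without leaving the range where its
      size is constant.\<close>
    let ?cl = "\<lambda>t. max a (min b t)"
    let ?h = "\<lambda>t. filter_mset (\<lambda>y. y \<in> W) (f (?cl t))"
    have "mset_continuous Y (\<lambda>t. filter_mset (\<lambda>y. y \<in> W) (f t))"
      unfolding mset_continuous_def
    proof (intro allI impI)
      fix U k assume "openin Y U"
      then have "openin Y (W \<inter> U)" using Wo by blast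
      then show "open {s. k \<le> size (filter_mset (\<lambda>y. y \<in> U) (filter_mset (\<lambda>y. y \<in> W) (f s)))}"
        using f(1)[unfolded mset_continuous_def, rule_format, of "W \<inter> U" k] by (simp add: filter_filter_mset)
    qed
    then have "mset_continuous Y ?h"
      by (rule mset_continuous_compose) (intro continuous_intros)
    moreover have "size (?h t) = ?c W s1" for t
      using s by (intro Wc) auto
    moreover have "set_mset (?h t) \<subseteq> topspace Y" for t
      using f(3) by auto
    moreover have "v \<in># ?h s" using v W s by (auto simp: max_absorb2 min_absorb2)
    ultimately obtain g where g: "continuous_map euclideanreal Y g" "\<And>t. g t \<in># ?h t" "g s = v"
      using IH Wn by blast
    have "g t \<in># f t" if "t \<in> {a..b}" for t
      using g(2)[of t] that by (auto simp: max_absorb2 min_absorb2)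
    then show "\<exists>g. selects_on Y f {a..b} g \<and> g s = v"
      using g by (intro exI[of _ g]) (auto simp: selects_on_def continuous_map_from_subtopology)
  qed
  ultimately show ?thesis using d(1) by blast
qed

theorem mset_path_selection:
  assumes Y: "Hausdorff_space Y"
  shows "mset_continuous Y f \<Longrightarrow> (\<And>s. size (f s) = n) \<Longrightarrow> (\<And>s. set_mset (f s) \<subseteq> topspace Y)
    \<Longrightarrow> v \<in># f s0 \<Longrightarrow> \<exists>g. continuous_map euclideanreal Y g \<and> (\<forall>s. g s \<in># f s) \<and> g s0 = v"
proof (induction n arbitrary: f v s0 rule: less_induct)
  case (less n)
  note f = less.prems(1-3)
  \<comment> \<open>Selections are built on the components of the complement of \<open>C\<close>. On \<open>C\<close> the value is forced and
    continuity holds there for any choice made nearby.\<close>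
  define C where "C = {s. \<exists>y. f s = replicate_mset n y}"
  have n: "n \<ge> 1"
    using less.prems(4) f(2)[of s0] by (cases n) auto
  have IH: "\<forall>m<n. \<forall>h v s0. mset_continuous Y h \<longrightarrow> (\<forall>s. size (h s) = m) \<longrightarrow>
       (\<forall>s. set_mset (h s) \<subseteq> topspace Y) \<longrightarrow> v \<in># h s0 \<longrightarrow>
       (\<exists>g. continuous_map euclideanreal Y g \<and> (\<forall>s. g s \<in># h s) \<and> g s0 = v)"
    using less.IH by blast
  have "open (- C)"
    unfolding open_dist dist_real_def
  proof
    fix s1 assume "s1 \<in> - C"
    then have "f s1 \<noteq> replicate_mset n y" for y by (auto simp: C_def)
    from locally_selectable[OF Y n IH f this] show "\<exists>e>0. \<forall>s. \<bar>s - s1\<bar> < e \<longrightarrow> s \<in> - C"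
      unfolding C_def by blast
  qed
  have on_J: "\<exists>g. selects_on Y f J g \<and> g s1 = w"
    if J: "open J" "connected J" "J \<inter> C = {}" and s1: "s1 \<in> J" "w \<in># f s1" for J s1 w
  proof -
    \<comment> \<open>Transport to the line: compact intervals are handled by chaining local
      selections, and these are then exhausted.\<close>
    obtain \<phi> \<psi> where hom: "homeomorphism (UNIV :: real set) J \<phi> \<psi>"
      using open_connected_real_homeomorphic_UNIV[OF J(1,2)] s1(1) unfolding homeomorphic_def by auto
    then have \<phi>: "continuous_on UNIV \<phi>" "\<And>t. \<phi> t \<in> J" "\<And>t. \<psi> (\<phi> t) = t"
      and \<psi>: "continuous_on J \<psi>" "\<And>s. s \<in> J \<Longrightarrow> \<phi> (\<psi> s) = s"
      by (auto simp: homeomorphism_def)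
    have "selectable Y (\<lambda>t. f (\<phi> t)) {a..b}" if "a \<le> b" for a b
      using that
    proof (induction rule: Bolzano)
      case (trans a b c)
      then show ?case by (rule selectable_trans)
    next
      case (local t)
      have "f (\<phi> t) \<noteq> replicate_mset n y" for y
        using \<phi>(2)[of t] J by (auto simp: C_def)
      from locally_selectable[OF Y n IH mset_continuous_compose[OF f(1) \<phi>(1)] f(2,3) this]
      obtain d where "d > 0"
        "\<And>a b. t - d < a \<Longrightarrow> b < t + d \<Longrightarrow> selectable Y (\<lambda>t. f (\<phi> t)) {a..b}"
        by blast
      then show ?case by (intro exI[of _ d]) auto
    qed
    then obtain g where g: "selects_on Y (\<lambda>t. f (\<phi> t)) UNIV g" "g (\<psi> s1) = w"
      using selects_on_UNIV_if_compact[of Y "\<lambda>t. f (\<phi> t)" w "\<psi> s1"] \<psi> s1 by auto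
    have "selects_on Y f J (\<lambda>s. g (\<psi> s))"
      unfolding selects_on_def
    proof (intro conjI ballI)
      show "continuous_map (top_of_set J) Y (\<lambda>s. g (\<psi> s))"
        by (rule continuous_map_compose[of _ euclideanreal, unfolded o_def])
          (use \<psi>(1) g(1) in \<open>auto simp: selects_on_def\<close>)
      show "g (\<psi> s) \<in># f s" if "s \<in> J" for s
        using g(1) \<psi>(2)[OF that] unfolding selects_on_def by (metis UNIV_I)
    qed
    then show ?thesis using g(2) by (intro exI[of _ "\<lambda>s. g (\<psi> s)"]) auto
  qed
  let ?J = "connected_component_set (- C)"
  define good where "good J g \<longleftrightarrow> selects_on Y f J g \<and> (s0 \<in> J \<longrightarrow> g s0 = v)" for J g
  have Jdisj: "?J s \<inter> C = {}" for s
    using connected_component_subset[of "- C" s] by blast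
  have "\<exists>g. good (?J s) g" if "s \<notin> C" for s
  proof (cases "s0 \<in> ?J s")
    case True
    then show ?thesis
      using on_J[of "?J s" s0 v] less.prems(4) \<open>open (- C)\<close> Jdisj[of s]
      by (auto simp: good_def open_connected_component)
  next
    case False
    obtain w where "w \<in># f s"
      using f(2)[of s] n by (metis multiset_nonemptyE not_one_le_zero size_empty)
    then show ?thesis
      using on_J[of "?J s" s w] False that \<open>open (- C)\<close> Jdisj[of s]
      by (auto simp: good_def open_connected_component connected_component_refl)
  qed
  then obtain G where G: "\<And>s. s \<notin> C \<Longrightarrow> good (?J s) (G (?J s))"
    using someI_ex[of "good (?J _)"] by (intro that[of "\<lambda>J. SOME g. good J g"]) blast
  \<comment> \<open>The separate value at \<open>s0\<close> creates no conflict: on \<open>C\<close>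
    all points of the multiset coincide, so \<open>v\<close> is forced, and off \<open>C\<close> the
    predicate \<open>good\<close> has already arranged the value \<open>v\<close>.\<close>
  define g where "g s = (if s = s0 then v else if s \<in> C then (SOME y. y \<in># f s) else G (?J s) s)" for s
  have gG: "g s = G (?J s) s" if "s \<notin> C" for s
    using G[OF that] that by (auto simp: g_def good_def connected_component_refl)
  have gf: "g s \<in># f s" for s
  proof (cases "s \<in> C")
    case True
    then show ?thesis
      using less.prems(4) n by (cases "s = s0") (auto simp: g_def C_def)
  next
    case False
    then have "s \<in> ?J s" by (simp add: connected_component_refl)
    then show ?thesis using G[OF False] gG[OF False] by (simp add: good_def selects_on_def)
  qed
  have "continuous_map euclideanreal Y g"
    unfolding continuous_map_eq_topcontinuous_at topcontinuous_at_def
  proof (intro ballI conjI allI impI)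
    fix s1 V assume V: "openin Y V \<and> g s1 \<in> V"
    show "\<exists>U. openin euclideanreal U \<and> s1 \<in> U \<and> (\<forall>s\<in>U. g s \<in> V)"
    proof (cases "s1 \<in> C")
      case True
      \<comment> \<open>Membership in \<open>?U\<close> says that all \<open>n\<close> points lie in
        \<open>V\<close>, so every choice there lies in \<open>V\<close>.\<close>
      let ?U = "{s. n \<le> size (filter_mset (\<lambda>y. y \<in> V) (f s))}"
      obtain y where y: "f s1 = replicate_mset n y" using True by (auto simp: C_def)
      then have "y \<in> V" using gf[of s1] V n by auto
      then have "filter_mset (\<lambda>y. y \<in> V) (f s1) = f s1"
        by (auto simp: y filter_mset_eq_conv)
      then have "s1 \<in> ?U" using f(2) by simp
      moreover have "g s \<in> V" if "s \<in> ?U" for s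
        using size_filter_mset_disjoint(2)[of V "{}" "f s"] that f(2)[of s] gf[of s] by auto
      moreover have "open ?U" using f(1) V by (simp add: mset_continuous_def)
      ultimately show ?thesis by (intro exI[of _ ?U]) auto
    next
      case False
      have J: "open (?J s1)" "s1 \<in> ?J s1"
        using \<open>open (- C)\<close> False by (auto simp: open_connected_component connected_component_refl)
      have same: "g s = G (?J s1) s" if "s \<in> ?J s1" for s
        using gG[of s] that connected_component_eq[OF that] connected_component_subset[of "- C" s1] by auto
      have "continuous_map (top_of_set (?J s1)) Y (G (?J s1))"
        using G[OF False] by (simp add: good_def selects_on_def)
      then have "openin (top_of_set (?J s1)) {s \<in> ?J s1. G (?J s1) s \<in> V}"
        using openin_continuous_map_preimage V by fastforce
      then have "open {s \<in> ?J s1. G (?J s1) s \<in> V}"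
        using J(1) openin_open_trans by blast
      then show ?thesis
        using J V same by (intro exI[of _ "{s \<in> ?J s1. G (?J s1) s \<in> V}"]) auto
    qed
  qed (use gf f(3) in auto)
  moreover have "g s0 = v" by (simp add: g_def)
  ultimately show ?case using gf by blast
qed

text \<open>One continuous selection is removed at a time. The work is to see that the remaining
  multiset is still \<open>mset_continuous\<close>: its count in \<open>V\<close> is smaller by one
  exactly where the selected point lies in \<open>V\<close>, so the selected point must be kept from
  entering the set used for counting.\<close>

theorem mset_path_lift:
  assumes Y: "Hausdorff_space Y"
  shows "mset_continuous Y f \<Longrightarrow> (\<And>s. size (f s) = n) \<Longrightarrow> (\<And>s. set_mset (f s) \<subseteq> topspace Y)
    \<Longrightarrow> \<exists>y. (\<forall>i<n. continuous_map euclideanreal Y (y i)) \<and>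
          (\<forall>s. f s = image_mset (\<lambda>i. y i s) (mset_set {..<n}))"
proof (induction n arbitrary: f)
  case 0
  then show ?case by simp
next
  case (Suc n)
  note f = Suc.prems
  obtain v where "v \<in># f 0"
    using f(2)[of 0] by (metis multiset_nonemptyE nat.distinct(1) size_empty)
  then obtain g where g: "continuous_map euclideanreal Y g" "\<And>s. g s \<in># f s"
    using mset_path_selection[OF Y f] by blast
  let ?f' = "\<lambda>s. f s - {#g s#}"
  have "mset_continuous Y ?f'"
    unfolding mset_continuous_def
  proof (intro allI impI)
    fix V k assume V: "openin Y V"
    let ?c = "\<lambda>V s. size (filter_mset (\<lambda>y. y \<in> V) (f s))"
    let ?c' = "\<lambda>V s. size (filter_mset (\<lambda>y. y \<in> V) (?f' s))"
    have rem: "?c' V s = ?c V s - (if g s \<in> V then 1 else 0)" for V s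
      using g(2)[of s] by (simp add: size_Diff_singleton filter_diff_mset)
    show "open {s. k \<le> ?c' V s}"
      unfolding open_dist dist_real_def
    proof (intro ballI)
      fix s1 assume s1: "s1 \<in> {s. k \<le> ?c' V s}"
      \<comment> \<open>If the selected point lies outside \<open>V\<close>, shrink \<open>V\<close> so that it stays outside nearby.\<close>
      have k: "k \<le> ?c V s1 - (if g s1 \<in> V then 1 else 0)"
        using s1 unfolding mem_Collect_eq rem .
      obtain V' W where VW: "openin Y V'" "V' \<subseteq> V" "k + (if g s1 \<in> V' then 1 else 0) \<le> ?c V' s1"
        "openin Y W" "g s1 \<in> W" "g s1 \<in> V' \<or> W \<inter> V' = {}"
      proof (cases "g s1 \<in> V")
        case True
        have "?c V s1 \<ge> 1"
          using True g(2)[of s1] by (auto simp: Suc_le_eq nonempty_has_size[symmetric] filter_mset_eq_mempty_iff)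
        then show thesis
          using that[of V V] True V k by simp
      next
        case False
        have "g s1 \<in> topspace Y" using f(3) g(2) by blast
        then obtain W U where WU: "openin Y W" "openin Y U" "g s1 \<in> W"
          "set_mset (f s1) - {g s1} \<subseteq> U" "W \<inter> U = {}"
          using separate_point_from_finite[OF Y, of "set_mset (f s1) - {g s1}" "g s1"] f(3)[of s1] by blast
        have "filter_mset (\<lambda>y. y \<in> V \<inter> U) (f s1) = filter_mset (\<lambda>y. y \<in> V) (f s1)"
          using WU(4) False by (intro filter_mset_cong) auto
        then show thesis
          using that[of "V \<inter> U" W] WU V k False by auto
      qed
      have "open {s. g s \<in> W}"
        using openin_continuous_map_preimage[OF g(1) VW(4)] by simp
      then obtain d where d: "d > 0" "\<And>s. \<bar>s - s1\<bar> < d \<Longrightarrow> g s \<in> W"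
        using VW(5) unfolding open_dist dist_real_def by auto
      obtain d' where d': "d' > 0" "\<And>s. \<bar>s - s1\<bar> < d' \<Longrightarrow> k + (if g s1 \<in> V' then 1 else 0) \<le> ?c V' s"
        using mset_continuousD[OF f(1) VW(1,3)] by metis
      have "k \<le> ?c' V s" if "\<bar>s - s1\<bar> < min d d'" for s
      proof -
        have "k \<le> ?c' V' s"
          unfolding rem using VW(6) d(2)[of s] d'(2)[of s] that by (auto split: if_splits)
        also have "\<dots> \<le> ?c' V s"
          using VW(2) by (intro size_mset_mono filter_mset_mono_strong) auto
        finally show ?thesis .
      qed
      then show "\<exists>e>0. \<forall>s. \<bar>s - s1\<bar> < e \<longrightarrow> s \<in> {s. k \<le> ?c' V s}"
        using d d' by (intro exI[of _ "min d d'"]) auto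
    qed
  qed
  moreover have "size (?f' s) = n" for s using f(2)[of s] g(2)[of s] by (simp add: size_Diff_singleton)
  moreover have "set_mset (?f' s) \<subseteq> topspace Y" for s
    using f(3)[of s] by (meson in_diffD subset_iff)
  ultimately obtain y where y: "\<forall>i<n. continuous_map euclideanreal Y (y i)"
    "\<And>s. ?f' s = image_mset (\<lambda>i. y i s) (mset_set {..<n})"
    using Suc.IH[of ?f'] by blast
  have "f s = image_mset (\<lambda>i. (y(n := g)) i s) (mset_set {..<Suc n})" for s
  proof -
    have "f s = add_mset (g s) (image_mset (\<lambda>i. y i s) (mset_set {..<n}))"
      using g(2)[of s] y(2)[of s] by (metis insert_DiffM)
    also have "image_mset (\<lambda>i. y i s) (mset_set {..<n}) = image_mset (\<lambda>i. (y(n := g)) i s) (mset_set {..<n})"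
      by (intro image_mset_cong) auto
    finally show ?thesis by (simp add: lessThan_Suc)
  qed
  then show ?case
    using y(1) g(1) by (intro exI[of _ "y(n := g)"]) (auto simp: less_Suc_eq)
qed

subsection \<open>Coordinates and the minimal weight on the symmetric join\<close>

definition join_coords :: "'a topology \<Rightarrow> nat \<Rightarrow> (nat \<Rightarrow> 'a) \<Rightarrow> (nat \<Rightarrow> real) \<Rightarrow> bool" where
  "join_coords X n x t \<longleftrightarrow> (\<forall>i<n. x i \<in> topspace X \<and> 0 \<le> t i) \<and> (\<Sum>i<n. t i) = 1"

text \<open>Normalises values from index \<open>n\<close> on, so that coordinate functions need to
  be controlled only below \<open>n\<close>.\<close>

definition prejoin_point :: "nat \<Rightarrow> (nat \<Rightarrow> 'a) \<Rightarrow> (nat \<Rightarrow> real) \<Rightarrow> (nat \<Rightarrow> 'a) \<times> (nat \<Rightarrow> real)" where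
  "prejoin_point n x t = (restrict x {..<n}, \<lambda>i. if i < n then t i else 0)"

definition join_class :: "'a topology \<Rightarrow> nat \<Rightarrow> (nat \<Rightarrow> 'a) \<times> (nat \<Rightarrow> real) \<Rightarrow> ((nat \<Rightarrow> 'a) \<times> (nat \<Rightarrow> real)) set set" where
  "join_class X n z = sym_rel X n `` {join_rel X n `` {z}}"

definition join_point :: "'a topology \<Rightarrow> nat \<Rightarrow> (nat \<Rightarrow> 'a) \<Rightarrow> (nat \<Rightarrow> real) \<Rightarrow> ((nat \<Rightarrow> 'a) \<times> (nat \<Rightarrow> real)) set set" where
  "join_point X n x t = join_class X n (prejoin_point n x t)"

lemma quotient_map_join_class:
  "quotient_map (prejoin X n) (symmetric_join X n) (join_class X n)"
  using quotient_map_compose[OF quotient_map_quotient_topology quotient_map_quotient_topology,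
      of "prejoin X n" "join_rel X n" "sym_rel X n"]
  by (simp add: symmetric_join_def iterated_join_def join_class_def[abs_def] o_def)

lemma topspace_prejoin:
  assumes "n \<ge> 1"
  shows "topspace (prejoin X n) = {prejoin_point n x t |x t. join_coords X n x t}"
proof -
  have n: "{..n - 1} = {..<n}" using assms by auto
  have top: "topspace (prejoin X n) = ({..<n} \<rightarrow>\<^sub>E topspace X) \<times> standard_simplex (n - 1)"
    by (simp add: prejoin_def topspace_product_topology)
  have "prejoin_point n x t \<in> topspace (prejoin X n)" if "join_coords X n x t" for x t
  proof -
    have t: "0 \<le> t i" "t i \<le> 1" if "i < n" for i
    proof -
      show "0 \<le> t i" using \<open>join_coords X n x t\<close> that by (simp add: join_coords_def)
      have "t i \<le> (\<Sum>i<n. t i)"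
        using \<open>join_coords X n x t\<close> that by (intro member_le_sum) (auto simp: join_coords_def)
      then show "t i \<le> 1" using \<open>join_coords X n x t\<close> by (simp add: join_coords_def)
    qed
    have "(\<Sum>i<n. if i < n then t i else 0) = (\<Sum>i<n. t i)"
      by (intro sum.cong) auto
    then show ?thesis
      using that t assms unfolding top prejoin_point_def standard_simplex_def n
      by (auto simp: join_coords_def)
  qed
  moreover have "\<exists>x t. z = prejoin_point n x t \<and> join_coords X n x t" if "z \<in> topspace (prejoin X n)" for z
  proof -
    obtain x t where z: "z = (x, t)" by (cases z)
    have x: "x \<in> {..<n} \<rightarrow>\<^sub>E topspace X" and t: "t \<in> standard_simplex (n - 1)"
      using that unfolding top z by auto
    have "(\<lambda>i. if i < n then t i else 0) = t"
      using t assms by (auto simp: standard_simplex_def fun_eq_iff)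
    moreover have "restrict x {..<n} = x"
      using x by (simp add: PiE_restrict)
    moreover have "join_coords X n x t"
      using x t n by (auto simp: join_coords_def standard_simplex_def)
    ultimately show ?thesis
      unfolding z prejoin_point_def by metis
  qed
  ultimately show ?thesis by blast
qed

text \<open>The two successive quotients reduce to one condition on coordinates, because a
  permutation acts on a class of the join through any representative.\<close>

lemma join_point_eq_iff:
  assumes n: "n \<ge> 1" and xt: "join_coords X n x t" and xt': "join_coords X n x' t'"
  shows "join_point X n x t = join_point X n x' t' \<longleftrightarrow>
    (\<exists>\<sigma>. \<sigma> permutes {..<n} \<and> (\<forall>i<n. t' i = t (\<sigma> i) \<and> (t' i \<noteq> 0 \<longrightarrow> x' i = x (\<sigma> i))))"
proof -
  let ?z = "prejoin_point n x t" and ?z' = "prejoin_point n x' t'"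
  let ?J = "\<lambda>z. join_rel X n `` {z}"
  have z: "?z \<in> topspace (prejoin X n)" "?z' \<in> topspace (prejoin X n)"
    using topspace_prejoin[OF n] xt xt' by blast+
  then have J: "?J ?z \<in> topspace (iterated_join X n)" "?J ?z' \<in> topspace (iterated_join X n)"
    by (auto simp: iterated_join_def quotientI)
  have "join_point X n x t = join_point X n x' t' \<longleftrightarrow> (?J ?z, ?J ?z') \<in> sym_rel X n"
    unfolding join_point_def join_class_def
    by (rule eq_equiv_class_iff[OF equiv_sym_rel J])
  also have "\<dots> \<longleftrightarrow> (\<exists>\<sigma>. \<sigma> permutes {..<n} \<and> ?J ?z' = ?J (permute_coords \<sigma> ?z))"
    unfolding sym_rel_def using J permute_coords_class[OF _ n z(1)] by (auto; metis)
  also have "\<dots> \<longleftrightarrow> (\<exists>\<sigma>. \<sigma> permutes {..<n} \<and> (permute_coords \<sigma> ?z, ?z') \<in> join_rel X n)"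
    using eq_equiv_class_iff[OF equiv_join_rel permute_coords_prejoin[OF _ n z(1)] z(2)] by metis
  also have "\<dots> \<longleftrightarrow> (\<exists>\<sigma>. \<sigma> permutes {..<n} \<and> (\<forall>i<n. t' i = t (\<sigma> i) \<and> (t' i \<noteq> 0 \<longrightarrow> x' i = x (\<sigma> i))))"
  proof (intro ex_cong1 conj_cong refl)
    fix \<sigma> assume \<sigma>: "\<sigma> permutes {..<n}"
    have lt: "\<sigma> i < n \<longleftrightarrow> i < n" for i
      using permutes_in_image[OF \<sigma>, of i] by simp
    show "(permute_coords \<sigma> ?z, ?z') \<in> join_rel X n \<longleftrightarrow>
        (\<forall>i<n. t' i = t (\<sigma> i) \<and> (t' i \<noteq> 0 \<longrightarrow> x' i = x (\<sigma> i)))"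
      using permute_coords_prejoin[OF \<sigma> n z(1)] z(2)
      unfolding join_rel_def prejoin_point_def permute_coords_def
      by (auto simp: fun_eq_iff lt; metis)
  qed
  finally show ?thesis .
qed

lemma join_point_surj:
  assumes "n \<ge> 1" "y \<in> topspace (symmetric_join X n)"
  obtains x t where "join_coords X n x t" "y = join_point X n x t"
proof -
  have "y \<in> join_class X n ` topspace (prejoin X n)"
    using assms(2) quotient_imp_surjective_map[OF quotient_map_join_class] by blast
  then show thesis
    using that unfolding topspace_prejoin[OF assms(1)] join_point_def by blast
qed

lemma continuous_map_prejoin_point:
  assumes n: "n \<ge> 1"
    and x: "\<And>i. i < n \<Longrightarrow> continuous_map T X (x i)"
    and t: "\<And>i. i < n \<Longrightarrow> continuous_map T euclideanreal (t i)"
    and coords: "\<And>w. w \<in> topspace T \<Longrightarrow> join_coords X n (\<lambda>i. x i w) (\<lambda>i. t i w)"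
  shows "continuous_map T (prejoin X n) (\<lambda>w. prejoin_point n (\<lambda>i. x i w) (\<lambda>i. t i w))"
proof -
  have top: "prejoin_point n (\<lambda>i. x i w) (\<lambda>i. t i w) \<in> topspace (prejoin X n)" if "w \<in> topspace T" for w
    using coords[OF that] topspace_prejoin[OF n] by blast
  have "continuous_map T (product_topology (\<lambda>_. X) {..<n}) (\<lambda>w. restrict (\<lambda>i. x i w) {..<n})"
    unfolding continuous_map_componentwise using x by (auto elim: continuous_map_eq)
  moreover have "continuous_map T (subtopology (powertop_real UNIV) (standard_simplex (n - 1)))
      (\<lambda>w i. if i < n then t i w else 0)"
    unfolding continuous_map_in_subtopology continuous_map_componentwise_UNIV
  proof
    show "\<forall>k. continuous_map T euclideanreal (\<lambda>w. if k < n then t k w else 0)"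
      using t by (auto intro: continuous_map_eq)
    show "(\<lambda>w i. if i < n then t i w else 0) \<in> topspace T \<rightarrow> standard_simplex (n - 1)"
      using top by (auto simp: prejoin_def prejoin_point_def)
  qed
  ultimately show ?thesis
    unfolding prejoin_def prejoin_point_def by (simp add: continuous_map_pairedI)
qed

lemma continuous_map_join_point:
  assumes "n \<ge> 1"
    and "\<And>i. i < n \<Longrightarrow> continuous_map T X (x i)"
    and "\<And>i. i < n \<Longrightarrow> continuous_map T euclideanreal (t i)"
    and "\<And>w. w \<in> topspace T \<Longrightarrow> join_coords X n (\<lambda>i. x i w) (\<lambda>i. t i w)"
  shows "continuous_map T (symmetric_join X n) (\<lambda>w. join_point X n (\<lambda>i. x i w) (\<lambda>i. t i w))"
  unfolding join_point_def
  using continuous_map_compose[OF continuous_map_prejoin_point[OF assms]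
      quotient_imp_continuous_map[OF quotient_map_join_class]]
  by (simp add: o_def)

lemma continuous_map_prejoin_coords:
  shows "i < n \<Longrightarrow> continuous_map (prejoin X n) X (\<lambda>z. fst z i)"
    and "continuous_map (prejoin X n) euclideanreal (\<lambda>z. snd z i)"
proof -
  show "continuous_map (prejoin X n) X (\<lambda>z. fst z i)" if "i < n"
    unfolding prejoin_def
    using that by (intro continuous_map_compose[OF continuous_map_fst continuous_map_product_projection, unfolded o_def]) auto
  have "continuous_map (subtopology (powertop_real UNIV) (standard_simplex (n - 1))) euclideanreal (\<lambda>t. t i)"
    by (intro continuous_map_from_subtopology continuous_map_product_projection) auto
  then show "continuous_map (prejoin X n) euclideanreal (\<lambda>z. snd z i)"
    unfolding prejoin_def
    by (rule continuous_map_compose[OF continuous_map_snd, unfolded o_def])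
qed

lemma prejoin_coords:
  assumes "n \<ge> 1" "z \<in> topspace (prejoin X n)"
  shows "join_coords X n (fst z) (snd z)" "join_class X n z = join_point X n (fst z) (snd z)"
proof -
  obtain x t where z: "z = prejoin_point n x t" "join_coords X n x t"
    using assms topspace_prejoin by blast
  have "(\<Sum>i<n. if i < n then t i else 0) = (\<Sum>i<n. t i)"
    by (intro sum.cong) auto
  then show "join_coords X n (fst z) (snd z)"
    using z(2) by (simp add: z(1) join_coords_def prejoin_point_def)
  have "prejoin_point n (fst z) (snd z) = z"
    by (auto simp: z(1) prejoin_point_def fun_eq_iff)
  then show "join_class X n z = join_point X n (fst z) (snd z)"
    by (simp add: join_point_def)
qed

lemma join_coords_permute:
  assumes "n \<ge> 1" "join_coords X n x t" and \<sigma>: "\<sigma> permutes {..<n}"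
  shows "join_coords X n (x \<circ> \<sigma>) (t \<circ> \<sigma>)" "join_point X n (x \<circ> \<sigma>) (t \<circ> \<sigma>) = join_point X n x t"
proof -
  have "\<sigma> i < n" if "i < n" for i
    using permutes_in_image[OF \<sigma>, of i] that by simp
  moreover have "(\<Sum>i<n. t (\<sigma> i)) = (\<Sum>i<n. t i)"
    using sum.permute[OF \<sigma>, of t] by (simp add: o_def)
  ultimately show coords: "join_coords X n (x \<circ> \<sigma>) (t \<circ> \<sigma>)"
    using assms(2) by (simp add: join_coords_def)
  show "join_point X n (x \<circ> \<sigma>) (t \<circ> \<sigma>) = join_point X n x t"
    using join_point_eq_iff[OF assms(1,2) coords] \<sigma> by auto
qed

section \<open>Representatives with the lightest slot last, and the minimal weight\<close>

definition last_min :: "nat \<Rightarrow> (nat \<Rightarrow> real) \<Rightarrow> bool" where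
  "last_min n t \<longleftrightarrow> (\<forall>i<n. t (n - 1) \<le> t i)"

lemma last_min_transpose:
  assumes "n \<ge> 1"
  obtains j where "j < n" "last_min n (t \<circ> Transposition.transpose j (n - 1))"
proof -
  obtain j where j: "j < n" "\<And>i. i < n \<Longrightarrow> t j \<le> t i"
    using ex_min_if_finite[of "t ` {..<n}"] assms by (force simp: not_less)
  have "last_min n (t \<circ> Transposition.transpose j (n - 1))"
    using j assms by (auto simp: last_min_def Transposition.transpose_def)
  with j(1) show thesis by (rule that)
qed

lemma transpose_last_permutes:
  fixes n :: nat
  shows "j < n \<Longrightarrow> Transposition.transpose j (n - 1) permutes {..<n}"
  by (cases n) (auto intro!: permutes_swap_id)

lemma join_point_last_min:
  assumes n: "n \<ge> 1" and y: "y \<in> topspace (symmetric_join X n)"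
  obtains x t where "join_coords X n x t" "last_min n t" "y = join_point X n x t"
proof -
  obtain x t where xt: "join_coords X n x t" "y = join_point X n x t"
    using join_point_surj[OF n y] by blast
  obtain j where j: "j < n" "last_min n (t \<circ> Transposition.transpose j (n - 1))"
    using last_min_transpose[OF n] by blast
  show thesis
    using that[OF _ j(2)] join_coords_permute[OF n xt(1) transpose_last_permutes[OF j(1)]] xt(2) by simp
qed

text \<open>Both numbers are the minimum of the same weights in different order.\<close>

lemma last_min_permute_eq:
  assumes "n \<ge> 1" "last_min n t" "last_min n t'" "\<sigma> permutes {..<n}" "\<forall>i<n. t' i = t (\<sigma> i)"
  shows "t' (n - 1) = t (n - 1)"
proof (rule antisym)
  have "n - 1 \<in> \<sigma> ` {..<n}"
    using permutes_image[OF assms(4)] assms(1) by simp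
  then obtain i where i: "i < n" "n - 1 = \<sigma> i" by auto
  then show "t' (n - 1) \<le> t (n - 1)"
    using assms(3,5) by (auto simp: last_min_def)
  have "\<sigma> (n - 1) < n"
    using permutes_in_image[OF assms(4), of "n - 1"] assms(1) by simp
  then show "t (n - 1) \<le> t' (n - 1)"
    using assms(1,2,5) by (auto simp: last_min_def)
qed

definition last_min_region :: "'a topology \<Rightarrow> nat \<Rightarrow> ((nat \<Rightarrow> 'a) \<times> (nat \<Rightarrow> real)) set" where
  "last_min_region X n = {z \<in> topspace (prejoin X n). last_min n (snd z)}"

lemma closedin_last_min_region:
  assumes "n \<ge> 1"
  shows "closedin (prejoin X n) (last_min_region X n)"
proof -
  have "last_min_region X n =
      (\<Inter>i<n. {z \<in> topspace (prejoin X n). snd z i - snd z (n - 1) \<in> {0..}})"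
    using assms by (auto simp: last_min_region_def last_min_def Suc_le_eq)
  also have "closedin (prejoin X n) \<dots>"
  proof (rule closedin_INT)
    show "{..<n} \<noteq> {}" using assms by (simp add: lessThan_empty_iff)
  qed (intro closedin_continuous_map_preimage[where Y = euclideanreal]
      continuous_map_diff continuous_map_prejoin_coords, simp)
  finally show ?thesis .
qed

text \<open>The translates of the region under the symmetric group form a finite closed cover, so the quotient map
  stays a quotient map on the region, where the slot of minimal weight is fixed.\<close>

lemma quotient_map_last_min:
  assumes n: "n \<ge> 1"
  shows "quotient_map (subtopology (prejoin X n) (last_min_region X n)) (symmetric_join X n) (join_class X n)"
    (is "quotient_map ?F ?S ?q")
  unfolding quotient_map_closedin
proof (intro conjI allI impI)
  let ?P = "prejoin X n"
  have cont: "continuous_map ?P ?S ?q"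
    by (rule quotient_imp_continuous_map[OF quotient_map_join_class])
  have F: "topspace ?F = last_min_region X n"
    by (auto simp: last_min_region_def)
  show "?q ` topspace ?F = topspace ?S"
  proof
    show "?q ` topspace ?F \<subseteq> topspace ?S"
      using continuous_map_image_subset_topspace[OF cont] by auto
    show "topspace ?S \<subseteq> ?q ` topspace ?F"
    proof
      fix y assume "y \<in> topspace ?S"
      then obtain x t where xt: "join_coords X n x t" "last_min n t" "y = join_point X n x t"
        by (rule join_point_last_min[OF n])
      have "prejoin_point n x t \<in> topspace ?F"
        using xt(1,2) n topspace_prejoin[OF n, of X]
        by (auto simp: F last_min_region_def prejoin_point_def last_min_def)
      then show "y \<in> ?q ` topspace ?F"
        unfolding xt(3) join_point_def by blast
    qed
  qed
  fix V assume V: "V \<subseteq> topspace ?S"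
  show "closedin ?F {z \<in> topspace ?F. ?q z \<in> V} = closedin ?S V"
  proof
    assume "closedin ?S V"
    then show "closedin ?F {z \<in> topspace ?F. ?q z \<in> V}"
      by (intro closedin_continuous_map_preimage[OF continuous_map_from_subtopology[OF cont]])
  next
    assume "closedin ?F {z \<in> topspace ?F. ?q z \<in> V}"
    then have C: "closedin ?P {z \<in> topspace ?F. ?q z \<in> V}"
      using closedin_last_min_region[OF n] closedin_trans_full by blast
    let ?\<tau> = "\<lambda>j. Transposition.transpose j (n - 1)"
    let ?m = "\<lambda>j z. prejoin_point n (\<lambda>i. fst z (?\<tau> j i)) (\<lambda>i. snd z (?\<tau> j i))"
    have m: "continuous_map ?P ?P (?m j)" and qm: "\<And>z. z \<in> topspace ?P \<Longrightarrow> ?q (?m j z) = ?q z" if "j < n" for j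
    proof -
      have lt: "?\<tau> j i < n" if "i < n" for i
        using permutes_in_image[OF transpose_last_permutes[OF \<open>j < n\<close>], of i] that by simp
      show "continuous_map ?P ?P (?m j)"
        using lt join_coords_permute(1)[OF n prejoin_coords(1)[OF n] transpose_last_permutes[OF that]]
        by (intro continuous_map_prejoin_point[OF n] continuous_map_prejoin_coords) (auto simp: o_def)
      show "?q (?m j z) = ?q z" if "z \<in> topspace ?P" for z
        using join_coords_permute(2)[OF n prejoin_coords(1)[OF n that] transpose_last_permutes[OF \<open>j < n\<close>]]
          prejoin_coords(2)[OF n that] by (simp add: join_point_def o_def)
    qed
    \<comment> \<open>No swap \<open>?m j\<close> changes the class, and for each \<open>z\<close>
      some swap lands in the region. The full preimage of \<open>V\<close> is thus a finite union of
      preimages of one closed set under continuous maps.\<close>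
    have "{z \<in> topspace ?P. ?q z \<in> V} = (\<Union>j<n. {z \<in> topspace ?P. ?m j z \<in> {z \<in> topspace ?F. ?q z \<in> V}})"
    proof (intro equalityI subsetI)
      fix z assume z: "z \<in> {z \<in> topspace ?P. ?q z \<in> V}"
      obtain j where j: "j < n" "last_min n (snd z \<circ> ?\<tau> j)"
        using last_min_transpose[OF n] by blast
      have "last_min n (snd (?m j z))"
        using j(2) n by (auto simp: last_min_def prejoin_point_def)
      moreover have "?m j z \<in> topspace ?P"
        using continuous_map_image_subset_topspace[OF m[OF j(1)]] z by auto
      ultimately have "?m j z \<in> {z \<in> topspace ?F. ?q z \<in> V}"
        using qm[OF j(1)] z unfolding F last_min_region_def by simp
      then show "z \<in> (\<Union>j<n. {z \<in> topspace ?P. ?m j z \<in> {z \<in> topspace ?F. ?q z \<in> V}})"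
        using j(1) z by blast
    next
      fix z assume "z \<in> (\<Union>j<n. {z \<in> topspace ?P. ?m j z \<in> {z \<in> topspace ?F. ?q z \<in> V}})"
      then obtain j where "j < n" "z \<in> topspace ?P" "?q (?m j z) \<in> V" by blast
      then show "z \<in> {z \<in> topspace ?P. ?q z \<in> V}" using qm by simp
    qed
    also have "closedin ?P \<dots>"
    proof (rule closedin_Union)
      fix D assume "D \<in> (\<lambda>j. {z \<in> topspace ?P. ?m j z \<in> {z \<in> topspace ?F. ?q z \<in> V}}) ` {..<n}"
      then obtain j where "j < n" and D: "D = {z \<in> topspace ?P. ?m j z \<in> {z \<in> topspace ?F. ?q z \<in> V}}"
        by blast
      show "closedin ?P D"
        unfolding D by (rule closedin_continuous_map_preimage[OF m[OF \<open>j < n\<close>] C])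
    qed simp
    finally have "closedin ?P {z \<in> topspace ?P. ?q z \<in> V}" .
    then show "closedin ?S V"
      using quotient_map_join_class[of X n] V unfolding quotient_map_closedin by blast
  qed
qed

definition min_weight :: "'a topology \<Rightarrow> nat \<Rightarrow> ((nat \<Rightarrow> 'a) \<times> (nat \<Rightarrow> real)) set set \<Rightarrow> real" where
  "min_weight X n y = (let z = SOME z. z \<in> topspace (prejoin X n) \<and> join_class X n z = y
     in Min (snd z ` {..<n}))"

text \<open>The chosen representative has the same weights up to a permutation of the slots, so the
  minimum does not depend on it.\<close>

lemma min_weight_join_point:
  assumes n: "n \<ge> 1" and xt: "join_coords X n x t"
  shows "min_weight X n (join_point X n x t) = Min (t ` {..<n})"
proof -
  define z where "z = (SOME z. z \<in> topspace (prejoin X n) \<and> join_class X n z = join_point X n x t)"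
  have "\<exists>z. z \<in> topspace (prejoin X n) \<and> join_class X n z = join_point X n x t"
    using xt topspace_prejoin[OF n] unfolding join_point_def by blast
  then have z: "z \<in> topspace (prejoin X n)" "join_class X n z = join_point X n x t"
    unfolding z_def by (metis (mono_tags, lifting) someI_ex)+
  obtain \<sigma> where \<sigma>: "\<sigma> permutes {..<n}" "\<forall>i<n. snd z i = t (\<sigma> i)"
    using z(2) join_point_eq_iff[OF n xt prejoin_coords(1)[OF n z(1)]] prejoin_coords(2)[OF n z(1)] by metis
  have "snd z ` {..<n} = t ` \<sigma> ` {..<n}"
    unfolding image_image using \<sigma>(2) by (intro image_cong) auto
  then show ?thesis
    unfolding min_weight_def z_def[symmetric] Let_def by (simp add: permutes_image[OF \<sigma>(1)])
qed

lemma Min_last_min: "n \<ge> 1 \<Longrightarrow> last_min n t \<Longrightarrow> Min (t ` {..<n}) = t (n - 1)"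
  by (intro Min_eqI) (auto simp: last_min_def)

lemma min_weight_last_min:
  assumes "n \<ge> 1" "join_coords X n x t" "last_min n t"
  shows "min_weight X n (join_point X n x t) = t (n - 1)"
  using min_weight_join_point[OF assms(1,2)] Min_last_min[OF assms(1,3)] by simp

text \<open>On representatives with the lightest slot last, the function is a coordinate projection;
  since these representatives still carry the quotient topology, continuity descends.\<close>

lemma continuous_map_min_weight:
  assumes n: "n \<ge> 1"
  shows "continuous_map (symmetric_join X n) euclideanreal (min_weight X n)"
proof (rule continuous_compose_quotient_map[OF quotient_map_last_min[OF n]])
  have "continuous_map (subtopology (prejoin X n) (last_min_region X n)) euclideanreal (\<lambda>z. snd z (n - 1))"
    by (intro continuous_map_from_subtopology continuous_map_prejoin_coords)
  then show "continuous_map (subtopology (prejoin X n) (last_min_region X n)) euclideanreal (min_weight X n \<circ> join_class X n)"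
    by (rule continuous_map_eq)
      (auto simp: last_min_region_def prejoin_coords[OF n] min_weight_last_min[OF n])
qed

section \<open>Contraction of the set of minimal weight below \<open>1 / n\<close>\<close>

lemma homotopic_with_quotient:
  assumes q: "quotient_map Z Y q"
    and h: "continuous_map (prod_topology (top_of_set {0..1::real}) Z) S h"
    and compat: "\<And>u z z'. \<lbrakk>0 \<le> u; u \<le> 1; z \<in> topspace Z; z' \<in> topspace Z; q z = q z'\<rbrakk> \<Longrightarrow> h (u, z) = h (u, z')"
    and f: "\<And>z. z \<in> topspace Z \<Longrightarrow> h (0, z) = f (q z)"
    and g: "\<And>z. z \<in> topspace Z \<Longrightarrow> h (1, z) = g (q z)"
  shows "homotopic_with (\<lambda>_. True) Y S f g"
proof -
  \<comment> \<open>A product of quotient maps can fail to be one. Here the other factor is the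
    identity of the unit interval, which is locally compact Hausdorff, so the product is again a
    quotient map and \<open>h\<close> descends.\<close>
  have quot: "quotient_map (prod_topology (top_of_set {0..1::real}) Z) (prod_topology (top_of_set {0..1::real}) Y) (\<lambda>(u, z). (u, q z))"
    by (rule quotient_map_prod_right[OF _ _ q])
      (auto simp: Hausdorff_space_subtopology intro!: compact_imp_locally_compact_space
        simp: compact_space_subtopology compactin_euclidean_iff)
  have compat': "h w = h w'"
    if "w \<in> topspace (prod_topology (top_of_set {0..1::real}) Z)" "w' \<in> topspace (prod_topology (top_of_set {0..1::real}) Z)"
      "(case w of (u, z) \<Rightarrow> (u, q z)) = (case w' of (u, z) \<Rightarrow> (u, q z))" for w w'
  proof -
    obtain u z where w: "w = (u, z)" by (cases w)
    obtain u' z' where w': "w' = (u', z')" by (cases w')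
    have "u' = u" "q z = q z'" using that(3) by (simp_all add: w w')
    then show ?thesis
      using compat[of u z z'] that(1,2) by (simp add: w w')
  qed
  obtain k where k: "continuous_map (prod_topology (top_of_set {0..1::real}) Y) S k"
    "\<And>w. w \<in> topspace (prod_topology (top_of_set {0..1::real}) Z) \<Longrightarrow> k (case w of (u, z) \<Rightarrow> (u, q z)) = h w"
  proof (rule quotient_map_lift_exists[OF quot h])
    show "h w = h w'"
      if "w \<in> topspace (prod_topology (top_of_set {0..1::real}) Z)" "w' \<in> topspace (prod_topology (top_of_set {0..1::real}) Z)"
        "(case w of (u, z) \<Rightarrow> (u, q z)) = (case w' of (u, z) \<Rightarrow> (u, q z))" for w w'
      by (rule compat'[OF that])
    fix g assume "continuous_map (prod_topology (top_of_set {0..1::real}) Y) S g"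
      "\<And>w. w \<in> topspace (prod_topology (top_of_set {0..1::real}) Z) \<Longrightarrow> g (case w of (u, z) \<Rightarrow> (u, q z)) = h w"
    then show thesis by (rule that)
  qed
  have kq: "k (u, q z) = h (u, z)" if "0 \<le> u" "u \<le> 1" "z \<in> topspace Z" for u z
    using k(2)[of "(u, z)"] that by simp
  have surj: "\<exists>z\<in>topspace Z. y = q z" if "y \<in> topspace Y" for y
    using quotient_imp_surjective_map[OF q] that by blast
  show ?thesis
    unfolding homotopic_with[of Y "\<lambda>_. True", simplified]
  proof (intro exI[of _ k] conjI ballI k(1))
    fix y assume "y \<in> topspace Y"
    then obtain z where z: "z \<in> topspace Z" "y = q z" using surj by blast
    show "k (0, y) = f y" "k (1, y) = g y"
      using kq[of 0 z] kq[of 1 z] f[OF z(1)] g[OF z(1)] z by simp_all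
  qed
qed

text \<open>Guards the forgotten points: if a slot is empty, there is nothing to subtract, so
  lowering the weights cannot give weight to a slot whose point is arbitrary.\<close>

lemma last_min_eq_0:
  assumes "join_coords X n x t" "last_min n t" "i < n" "t i = 0"
  shows "t (n - 1) = 0"
proof (rule antisym)
  show "t (n - 1) \<le> 0" using assms(2-4) by (auto simp: last_min_def)
  show "0 \<le> t (n - 1)" using assms(1,3) by (simp add: join_coords_def)
qed

text \<open>Lowering all \<open>n\<close> weights by \<open>u * t (n - 1)\<close> leaves the total
  \<open>1 - n * u * t (n - 1)\<close>. The bound \<open>1 / n\<close> on the last weight keeps this
  positive, so the weights can be rescaled.\<close>

lemma join_coords_sub_min:
  assumes "n \<ge> 1" "join_coords X n x t" "last_min n t" "t (n - 1) < 1 / n" "0 \<le> u" "u \<le> 1"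
  shows "0 < 1 - n * u * t (n - 1)" (is ?pos)
    and "join_coords X n x (\<lambda>i. (t i - u * t (n - 1)) / (1 - n * u * t (n - 1)))" (is ?coords)
proof -
  let ?m = "t (n - 1)"
  have m: "0 \<le> ?m" "n * ?m < 1"
    using assms by (simp_all add: join_coords_def field_simps)
  have "u * (n * ?m) \<le> 1 * (n * ?m)"
    using m(1) assms(6) by (intro mult_right_mono) auto
  then show pos: ?pos
    using m(2) by (simp add: algebra_simps)
  have "u * ?m \<le> t i" if "i < n" for i
  proof -
    have "u * ?m \<le> 1 * ?m" using m(1) assms(6) by (intro mult_right_mono) auto
    also have "\<dots> \<le> t i" using assms(3) that by (simp add: last_min_def)
    finally show ?thesis .
  qed
  moreover have "(\<Sum>i<n. (t i - u * ?m) / (1 - n * u * ?m)) = (\<Sum>i<n. t i - u * ?m) / (1 - n * u * ?m)"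
    by (rule sum_divide_distrib[symmetric])
  moreover have "(\<Sum>i<n. t i - u * ?m) = 1 - n * u * ?m"
    using assms(2) by (simp add: sum_subtractf join_coords_def)
  ultimately show ?coords
    using pos assms(2) by (simp add: join_coords_def)
qed

text \<open>Weights after lowering all of them by the last, minimal one, with a new point of weight \<open>u\<close> in the
  vacated last slot.\<close>

definition drop_last :: "nat \<Rightarrow> (nat \<Rightarrow> real) \<Rightarrow> real \<Rightarrow> nat \<Rightarrow> real" where
  "drop_last n t u i = (1 - u) * ((t i - t (n - 1)) / (1 - n * t (n - 1))) + (if i = n - 1 then u else 0)"

lemma join_coords_drop_last:
  assumes n: "n \<ge> 1" and "join_coords X n x t" "last_min n t" "t (n - 1) < 1 / n" "0 \<le> u" "u \<le> 1"
    and "x0 \<in> topspace X"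
  shows "join_coords X n (x(n - 1 := x0)) (drop_last n t u)"
proof -
  have c: "join_coords X n x (\<lambda>i. (t i - t (n - 1)) / (1 - n * t (n - 1)))"
    using join_coords_sub_min(2)[OF assms(1-4), of 1] by simp
  have "(\<Sum>i<n. drop_last n t u i) =
      (1 - u) * (\<Sum>i<n. (t i - t (n - 1)) / (1 - n * t (n - 1))) + (\<Sum>i<n. if i = n - 1 then u else 0)"
    unfolding drop_last_def by (simp add: sum.distrib sum_distrib_left)
  also have "(\<Sum>i<n. (t i - t (n - 1)) / (1 - n * t (n - 1))) = 1"
    using c by (simp add: join_coords_def)
  also have "(\<Sum>i<n. if i = n - 1 then u else 0) = u"
    using n by (subst sum.delta) auto
  finally have "(\<Sum>i<n. drop_last n t u i) = 1" by simp
  moreover have "0 \<le> drop_last n t u i" if "i < n" for i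
    unfolding drop_last_def using c assms(5,6) that
    by (intro add_nonneg_nonneg mult_nonneg_nonneg) (auto simp: join_coords_def)
  ultimately show ?thesis
    using assms(2,7) by (simp add: join_coords_def)
qed

text \<open>Two homotopies are written on representatives and descend: \<open>h\<close> empties the
  lightest slot, \<open>k\<close> fills it with \<open>x0\<close>. For \<open>k\<close> the choice
  of the lightest slot matters, because its point is replaced; it is harmless because all tied slots
  are empty when \<open>k\<close> begins.\<close>

theorem noncentral_contractible:
  assumes n: "n \<ge> 1" and x0: "x0 \<in> topspace X"
  defines "S \<equiv> symmetric_join X n"
  shows "\<exists>c. homotopic_with (\<lambda>_. True)
           (subtopology S {y \<in> topspace S. min_weight X n y < 1 / n}) S (\<lambda>y. y) (\<lambda>_. c)"
proof -
  let ?A = "{y \<in> topspace S. min_weight X n y < 1 / n}"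
  let ?F = "subtopology (prejoin X n) (last_min_region X n)"
  let ?q = "join_class X n"
  \<comment> \<open>The representatives over \<open>?A\<close> with the lightest slot last.
    Restriction to the preimage of the open set \<open>?A\<close> keeps the quotient map.\<close>
  define Z where "Z = subtopology ?F {z \<in> topspace ?F. ?q z \<in> ?A}"
  have "?A = {y \<in> topspace S. min_weight X n y \<in> {..<1 / n}}" by auto
  then have A: "openin S ?A"
    using openin_continuous_map_preimage[OF continuous_map_min_weight[OF n, of X], of "{..<1 / n}"]
    by (simp add: S_def)
  have q: "quotient_map Z (subtopology S ?A) ?q"
    unfolding Z_def S_def[symmetric]
    by (rule quotient_map_restriction) (use quotient_map_last_min[OF n, of X] A in \<open>auto simp: S_def\<close>)
  have Z: "z \<in> topspace (prejoin X n)" "join_coords X n (fst z) (snd z)" "last_min n (snd z)"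
      "snd z (n - 1) < 1 / n" "?q z = join_point X n (fst z) (snd z)" if "z \<in> topspace Z"
    for z :: "(nat \<Rightarrow> 'a) \<times> (nat \<Rightarrow> real)"
  proof -
    show z: "z \<in> topspace (prejoin X n)" and lm: "last_min n (snd z)"
      using that by (auto simp: Z_def last_min_region_def)
    show c: "join_coords X n (fst z) (snd z)" and qz: "?q z = join_point X n (fst z) (snd z)"
      using prejoin_coords[OF n z] by auto
    have "min_weight X n (?q z) < 1 / n" using that by (auto simp: Z_def)
    then show "snd z (n - 1) < 1 / n"
      using min_weight_last_min[OF n c lm] by (simp add: qz)
  qed
  let ?T = "prod_topology (top_of_set {0..1::real}) Z"
  have contZ: "continuous_map ?T (prejoin X n) snd"
    unfolding Z_def by (intro continuous_map_into_fulltopology[OF continuous_map_into_fulltopology[OF continuous_map_snd]])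
  note contx = continuous_map_compose[OF contZ continuous_map_prejoin_coords(1), unfolded o_def]
    and contt = continuous_map_compose[OF contZ continuous_map_prejoin_coords(2), unfolded o_def]
  have contu: "continuous_map ?T euclideanreal fst"
    by (rule continuous_map_into_fulltopology[OF continuous_map_fst])
  have eqv: "\<exists>\<sigma>. \<sigma> permutes {..<n} \<and> (\<forall>i<n. snd z' i = snd z (\<sigma> i) \<and> (snd z' i \<noteq> 0 \<longrightarrow> fst z' i = fst z (\<sigma> i)))
      \<and> snd z' (n - 1) = snd z (n - 1)"
    if zs: "z \<in> topspace Z" "z' \<in> topspace Z" "?q z = ?q z'" for z z' :: "(nat \<Rightarrow> 'a) \<times> (nat \<Rightarrow> real)"
  proof -
    obtain \<sigma> where \<sigma>: "\<sigma> permutes {..<n}"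
      "\<forall>i<n. snd z' i = snd z (\<sigma> i) \<and> (snd z' i \<noteq> 0 \<longrightarrow> fst z' i = fst z (\<sigma> i))"
      using join_point_eq_iff[OF n Z(2)[OF zs(1)] Z(2)[OF zs(2)]] Z(5)[OF zs(1)] Z(5)[OF zs(2)] zs(3) by metis
    moreover have "snd z' (n - 1) = snd z (n - 1)"
      by (rule last_min_permute_eq[OF n Z(3)[OF zs(1)] Z(3)[OF zs(2)] \<sigma>(1)]) (use \<sigma>(2) in blast)
    ultimately show ?thesis by blast
  qed
  define h where "h w = join_point X n (fst (snd w))
      (\<lambda>i. (snd (snd w) i - fst w * snd (snd w) (n - 1)) / (1 - n * fst w * snd (snd w) (n - 1)))"
    for w :: "real \<times> (nat \<Rightarrow> 'a) \<times> (nat \<Rightarrow> real)"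
  have sub: "0 < 1 - n * u * snd z (n - 1)"
      "join_coords X n (fst z) (\<lambda>i. (snd z i - u * snd z (n - 1)) / (1 - n * u * snd z (n - 1)))"
    if "0 \<le> u" "u \<le> 1" "z \<in> topspace Z" for u :: real and z :: "(nat \<Rightarrow> 'a) \<times> (nat \<Rightarrow> real)"
    using join_coords_sub_min[OF n Z(2-4)[OF that(3)] that(1,2)] by auto
  have h: "continuous_map ?T S h"
    unfolding h_def S_def
  proof (rule continuous_map_join_point[OF n])
    show "continuous_map ?T euclideanreal
        (\<lambda>w. (snd (snd w) i - fst w * snd (snd w) (n - 1)) / (1 - n * fst w * snd (snd w) (n - 1)))" for i
    proof (intro continuous_map_real_divide continuous_map_diff continuous_map_real_mult contt contu)
      show "1 - real n * fst w * snd (snd w) (n - 1) \<noteq> 0" if "w \<in> topspace ?T" for w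
        using sub(1)[of "fst w" "snd w"] that by auto
    qed auto
  qed (use contx sub(2) in auto)
  define k where "k w = join_point X n ((fst (snd w))(n - 1 := x0)) (drop_last n (snd (snd w)) (fst w))"
    for w :: "real \<times> (nat \<Rightarrow> 'a) \<times> (nat \<Rightarrow> real)"
  have drop: "join_coords X n ((fst z)(n - 1 := x0)) (drop_last n (snd z) u)"
    if "0 \<le> u" "u \<le> 1" "z \<in> topspace Z" for u :: real and z :: "(nat \<Rightarrow> 'a) \<times> (nat \<Rightarrow> real)"
    by (rule join_coords_drop_last[OF n Z(2-4)[OF that(3)] that(1,2) x0])
  have k: "continuous_map ?T S k"
    unfolding k_def S_def
  proof (rule continuous_map_join_point[OF n])
    show "continuous_map ?T X (\<lambda>w. ((fst (snd w))(n - 1 := x0)) i)" if "i < n" for i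
      using contx[OF that] x0 by (cases "i = n - 1") auto
    show "continuous_map ?T euclideanreal (\<lambda>w. drop_last n (snd (snd w)) (fst w) i)" for i
      unfolding drop_last_def
    proof (intro continuous_map_real_divide continuous_map_diff continuous_map_add continuous_map_real_mult contt contu)
      show "1 - real n * snd (snd w) (n - 1) \<noteq> 0" if "w \<in> topspace ?T" for w
        using sub(1)[of 1 "snd w"] that by auto
    qed (use contu in auto)
    show "join_coords X n (\<lambda>i. ((fst (snd w))(n - 1 := x0)) i) (\<lambda>i. drop_last n (snd (snd w)) (fst w) i)"
      if "w \<in> topspace ?T" for w
      using drop[of "fst w" "snd w"] that by (simp add: mem_Times_iff del: fun_upd_apply)
  qed
  let ?z = "join_point X n (\<lambda>_. x0) (\<lambda>i. if i = n - 1 then 1 else 0)"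
  \<comment> \<open>Only names the common end of \<open>h\<close> and start of \<open>k\<close> as a
    function on the join. By \<open>hcompat\<close> the choice does not affect its value.\<close>
  let ?lift = "\<lambda>y. SOME z. z \<in> topspace Z \<and> ?q z = y"
  have lift: "?lift (?q z) \<in> topspace Z" "?q (?lift (?q z)) = ?q z" if "z \<in> topspace Z" for z
    using someI[of "\<lambda>z'. z' \<in> topspace Z \<and> ?q z' = ?q z" z] that by auto
  have hcompat: "h (u, z) = h (u, z')"
    if u: "0 \<le> u" "u \<le> 1" and z: "z \<in> topspace Z" "z' \<in> topspace Z" "?q z = ?q z'" for u :: real and z z' :: "(nat \<Rightarrow> 'a) \<times> (nat \<Rightarrow> real)"
  proof -
    obtain \<sigma> where \<sigma>: "\<sigma> permutes {..<n}" "\<forall>i<n. snd z' i = snd z (\<sigma> i) \<and> (snd z' i \<noteq> 0 \<longrightarrow> fst z' i = fst z (\<sigma> i))"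
      "snd z' (n - 1) = snd z (n - 1)"
      using eqv[OF z] by blast
    let ?w = "\<lambda>z i. (snd z i - u * snd z (n - 1)) / (1 - n * u * snd z (n - 1))"
    have "?w z' i = ?w z (\<sigma> i) \<and> (?w z' i \<noteq> 0 \<longrightarrow> fst z' i = fst z (\<sigma> i))" if "i < n" for i
    proof (cases "snd z' i = 0")
      case True
      have "snd z' (n - 1) = 0" by (rule last_min_eq_0[OF Z(2)[OF z(2)] Z(3)[OF z(2)] that True])
      then have "?w z' i = 0" "?w z (\<sigma> i) = 0" using True \<sigma>(2,3) that by simp_all
      then show ?thesis by metis
    next
      case False
      then have "snd z' i = snd z (\<sigma> i)" "fst z' i = fst z (\<sigma> i)" using \<sigma>(2) that by simp_all
      then show ?thesis using \<sigma>(3) by simp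
    qed
    then show ?thesis
      unfolding h_def fst_conv snd_conv join_point_eq_iff[OF n sub(2)[OF u z(1)] sub(2)[OF u z(2)]]
      using \<sigma>(1) by blast
  qed
  have kcompat: "k (u, z) = k (u, z')"
    if u: "0 \<le> u" "u \<le> 1" and z: "z \<in> topspace Z" "z' \<in> topspace Z" "?q z = ?q z'" for u :: real and z z' :: "(nat \<Rightarrow> 'a) \<times> (nat \<Rightarrow> real)"
  proof -
    obtain \<sigma> where \<sigma>: "\<sigma> permutes {..<n}" "\<forall>i<n. snd z' i = snd z (\<sigma> i) \<and> (snd z' i \<noteq> 0 \<longrightarrow> fst z' i = fst z (\<sigma> i))"
      "snd z' (n - 1) = snd z (n - 1)"
      using eqv[OF z] by blast
    let ?s = "\<sigma> (n - 1)"
    \<comment> \<open>Both the last slot and slot \<open>?s\<close> are empty after lowering the weights, so \<open>\<sigma>\<close> may be corrected to fix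
      the last slot.\<close>
    define \<tau> where "\<tau> = Transposition.transpose ?s (n - 1) \<circ> \<sigma>"
    have s: "?s < n" using permutes_in_image[OF \<sigma>(1), of "n - 1"] n by simp
    have ts: "snd z ?s = snd z (n - 1)" using \<sigma>(2,3) n by simp
    have \<tau>: "\<tau> permutes {..<n}"
      unfolding \<tau>_def by (rule permutes_compose[OF \<sigma>(1) transpose_last_permutes[OF s]])
    have \<tau>last: "\<tau> (n - 1) = n - 1" by (simp add: \<tau>_def)
    have inj: "\<sigma> i = ?s \<Longrightarrow> i = n - 1" for i
      using permutes_inj[OF \<sigma>(1)] by (simp add: inj_eq)
    have \<tau>i: "\<tau> i = (if \<sigma> i = n - 1 then ?s else \<sigma> i) \<and> \<tau> i \<noteq> n - 1" if "i \<noteq> n - 1" for i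
      using inj[of i] that inj[of "n - 1"] unfolding \<tau>_def by (auto simp: Transposition.transpose_def)
    have "drop_last n (snd z') u i = drop_last n (snd z) u (\<tau> i) \<and>
        (drop_last n (snd z') u i \<noteq> 0 \<longrightarrow> ((fst z')(n - 1 := x0)) i = ((fst z)(n - 1 := x0)) (\<tau> i))"
      if "i < n" for i
    proof (cases "i = n - 1")
      case True
      then show ?thesis using \<tau>last \<sigma>(3) by (simp add: drop_last_def)
    next
      case False
      show ?thesis
      proof (cases "\<sigma> i = n - 1")
        case True
        then have "snd z' i = snd z (n - 1)" using \<sigma>(2) that by simp
        then show ?thesis using \<tau>i[OF False] True False ts \<sigma>(3) by (simp add: drop_last_def)
      next
        case notlast: False
        have "snd z' i \<noteq> 0" if "drop_last n (snd z') u i \<noteq> 0"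
        proof
          assume 0: "snd z' i = 0"
          then have "snd z' (n - 1) = 0"
            by (rule last_min_eq_0[OF Z(2)[OF z(2)] Z(3)[OF z(2)] \<open>i < n\<close>])
          then show False using that 0 False by (simp add: drop_last_def)
        qed
        then show ?thesis
          using \<tau>i[OF False] notlast False \<sigma>(2,3) that by (simp add: drop_last_def)
      qed
    qed
    then show ?thesis
      unfolding k_def fst_conv snd_conv join_point_eq_iff[OF n drop[OF u z(1)] drop[OF u z(2)]]
      using \<tau> by blast
  qed
  \<comment> \<open>The weights agree, and the points differ at most in the last slot, whose weight
    is zero.\<close>
  have hk: "h (1, z) = k (0, z)" if "z \<in> topspace Z" for z
    unfolding h_def k_def fst_conv snd_conv
    by (subst join_point_eq_iff[OF n sub(2)[OF _ _ that] drop[OF _ _ that]])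
      (auto simp: drop_last_def intro!: exI[of _ id] permutes_id)
  have "homotopic_with (\<lambda>_. True) (subtopology S ?A) S (\<lambda>y. y) (\<lambda>y. h (1, ?lift y))"
  proof (rule homotopic_with_quotient[OF q h hcompat])
    show "h (0, z) = ?q z" if "z \<in> topspace Z" for z
      using Z(5)[OF that] by (simp add: h_def)
    show "h (1, z) = h (1, ?lift (?q z))" if "z \<in> topspace Z" for z
      using lift[OF that] that by (intro hcompat) auto
  qed
  moreover have "homotopic_with (\<lambda>_. True) (subtopology S ?A) S (\<lambda>y. h (1, ?lift y)) (\<lambda>_. ?z)"
  proof (rule homotopic_with_quotient[OF q k kcompat])
    show "k (0, z) = h (1, ?lift (?q z))" if "z \<in> topspace Z" for z
      using hcompat[of 1 z "?lift (?q z)"] lift[OF that] that hk[OF that] by simp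
    show "k (1, z) = ?z" if "z \<in> topspace Z" for z
    proof -
      have "join_coords X n (\<lambda>_. x0) (\<lambda>i. if i = n - 1 then 1 else 0)"
        using n x0 by (auto simp: join_coords_def)
      then show ?thesis
        unfolding k_def fst_conv snd_conv
        by (subst join_point_eq_iff[OF n drop[OF _ _ that]])
          (auto simp: drop_last_def intro!: exI[of _ id] permutes_id)
    qed
  qed
  ultimately show ?thesis
    using homotopic_with_trans by blast
qed

subsection \<open>Loops of positive minimal weight\<close>

lemma free_homotopyI:
  assumes "continuous_map (top_of_set unit_square) S h"
    and "\<And>u. 0 \<le> u \<Longrightarrow> u \<le> 1 \<Longrightarrow> h (u, 0) = h (u, 1)"
    and "\<And>s. 0 \<le> s \<Longrightarrow> s \<le> 1 \<Longrightarrow> h (0, s) = p s" "\<And>s. 0 \<le> s \<Longrightarrow> s \<le> 1 \<Longrightarrow> h (1, s) = q s"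
  shows "homotopic_with (\<lambda>r. r 0 = r 1) (top_of_set {0..1}) S p q"
  using assms by (subst homotopic_with) (auto simp: prod_topology_subtopology_eu intro!: exI[of _ h])

text \<open>Because of this, later homotopies need only keep the curve closed; the base point may
  move.\<close>

lemma loop_nullhomotopic_if_free_homotopic:
  assumes "homotopic_with (\<lambda>r. r 0 = r 1) (top_of_set {0..1::real}) S p (\<lambda>_. c)"
  shows "path_homotopic S (p 0) (p 0) p (\<lambda>_. p 0)"
proof -
  obtain h where h: "continuous_map (prod_topology (top_of_set {0..1}) (top_of_set {0..1})) S h"
    "\<forall>s. h (0, s) = p s" "\<forall>s. h (1, s) = c" "\<forall>u\<in>{0..1::real}. h (u, 0) = h (u, 1)"
    using assms unfolding homotopic_with_def by auto
  show ?thesis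
    by (rule loop_nullhomotopic_if_freely[of S h]) (use h in auto)
qed

lemma free_homotopic_const_if_contractible:
  assumes hom: "homotopic_with (\<lambda>_. True) (subtopology S A) S (\<lambda>y. y) (\<lambda>_. c)"
    and p: "pathin S p" "p 0 = p 1" "p ` {0..1} \<subseteq> A"
  shows "homotopic_with (\<lambda>r. r 0 = r 1) (top_of_set {0..1}) S p (\<lambda>_. c)"
proof -
  obtain h where h: "continuous_map (prod_topology (top_of_set {0..1}) (subtopology S A)) S h"
    "\<And>y. h (0::real, y) = y" "\<And>y. h (1, y) = c"
    using hom unfolding homotopic_with_def by auto
  have pA: "continuous_map (top_of_set {0..1}) (subtopology S A) p"
    using p(1,3) by (simp add: pathin_def continuous_map_into_subtopology image_subset_iff_funcset)
  have "continuous_map (prod_topology (top_of_set {0..1::real}) (top_of_set {0..1}))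
      (prod_topology (top_of_set {0..1}) (subtopology S A)) (\<lambda>w. (fst w, p (snd w)))"
    by (intro continuous_map_pairedI continuous_map_fst
        continuous_map_compose[OF continuous_map_snd pA, unfolded o_def])
  from continuous_map_compose[OF this h(1)]
  have "continuous_map (top_of_set unit_square) S (\<lambda>w. h (fst w, p (snd w)))"
    by (simp add: o_def)
  then show ?thesis
    by (rule free_homotopyI) (simp_all add: h p(2))
qed

lemma continuous_map_compose_unit:
  assumes "continuous_map (top_of_set {0..1::real}) X f" "continuous_on K g" "g ` K \<subseteq> {0..1}"
  shows "continuous_map (top_of_set K) X (\<lambda>w. f (g w))"
  using continuous_map_compose[of "top_of_set K" "top_of_set {0..1}" g X f] assms
  by (simp add: o_def image_subset_iff_funcset)

lemma join_coords_cong: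
  assumes "\<And>i. i < n \<Longrightarrow> x i = x' i" "\<And>i. i < n \<Longrightarrow> t i = t' i"
  shows "join_coords X n x t = join_coords X n x' t'" "join_point X n x t = join_point X n x' t'"
proof -
  have "(\<Sum>i<n. t i) = (\<Sum>i<n. t' i)" using assms by (intro sum.cong) auto
  then show "join_coords X n x t = join_coords X n x' t'"
    using assms by (auto simp: join_coords_def)
  have "prejoin_point n x t = prejoin_point n x' t'"
    using assms by (auto simp: prejoin_point_def fun_eq_iff)
  then show "join_point X n x t = join_point X n x' t'"
    by (simp add: join_point_def)
qed

lemma join_point_eqI:
  assumes "n \<ge> 1" "join_coords X n x t" "join_coords X n x' t'" "\<sigma> permutes {..<n}"
    and "\<And>i. i < n \<Longrightarrow> t' i = t (\<sigma> i)" "\<And>i. i < n \<Longrightarrow> t' i \<noteq> 0 \<Longrightarrow> x' i = x (\<sigma> i)"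
  shows "join_point X n x t = join_point X n x' t'"
  unfolding join_point_eq_iff[OF assms(1-3)] using assms(4-) by blast

section \<open>Points of positive weight as multisets, and the lifting of paths\<close>

definition configuration :: "nat \<Rightarrow> (nat \<Rightarrow> 'a) \<Rightarrow> (nat \<Rightarrow> real) \<Rightarrow> ('a \<times> real) multiset" where
  "configuration n x t = image_mset (\<lambda>i. (x i, t i)) (mset_set {..<n})"

lemma size_filter_configuration:
  "size (filter_mset P (configuration n x t)) = card {i. i < n \<and> P (x i, t i)}"
proof -
  have "filter_mset P (configuration n x t) = image_mset (\<lambda>i. (x i, t i)) (mset_set {i \<in> {..<n}. P (x i, t i)})"
    unfolding configuration_def by (simp add: filter_mset_image_mset filter_mset_mset_set)
  then show ?thesis by simp
qed

text \<open>With all weights positive the identification forgets no point, so the permutation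
  matches the pairs in all slots.\<close>

lemma configuration_eq_if_join_point_eq:
  assumes "n \<ge> 1" "join_coords X n x t" "join_coords X n x' t'"
    and "join_point X n x t = join_point X n x' t'" and pos: "\<And>i. i < n \<Longrightarrow> 0 < t' i"
  shows "configuration n x t = configuration n x' t'"
proof -
  obtain \<sigma> where \<sigma>: "\<sigma> permutes {..<n}" "\<forall>i<n. t' i = t (\<sigma> i) \<and> (t' i \<noteq> 0 \<longrightarrow> x' i = x (\<sigma> i))"
    using assms(4) unfolding join_point_eq_iff[OF assms(1-3)] by blast
  have "configuration n x' t' = image_mset (\<lambda>i. (x (\<sigma> i), t (\<sigma> i))) (mset_set {..<n})"
    unfolding configuration_def using \<sigma>(2) pos by (intro image_mset_cong) force
  also have "\<dots> = image_mset (\<lambda>i. (x i, t i)) (image_mset \<sigma> (mset_set {..<n}))"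
    by (simp add: multiset.map_comp o_def)
  also have "image_mset \<sigma> (mset_set {..<n}) = mset_set {..<n}"
    using permutes_inj_on[OF \<sigma>(1)] permutes_image[OF \<sigma>(1)] by (simp add: image_mset_mset_set)
  finally show ?thesis by (simp add: configuration_def)
qed

text \<open>At least \<open>k\<close> points lie in \<open>V\<close> exactly when some set of at
  least \<open>k\<close> slots is mapped into \<open>V\<close>; this is a finite union of finite
  intersections. Positivity is part of the set because only then does the configuration depend on
  the class alone, which is needed to pass to the quotient.\<close>

lemma openin_prejoin_configuration:
  assumes V: "openin (prod_topology X euclideanreal) V"
  shows "openin (prejoin X n) {z \<in> topspace (prejoin X n).
     (\<forall>i<n. 0 < snd z i) \<and> k \<le> size (filter_mset (\<lambda>y. y \<in> V) (configuration n (fst z) (snd z)))}"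
proof -
  let ?P = "prejoin X n"
  let ?O = "\<lambda>i. {z \<in> topspace ?P. (fst z i, snd z i) \<in> V}"
  have O: "openin ?P (?O i)" if "i < n" for i
    by (rule openin_continuous_map_preimage[OF _ V])
      (intro continuous_map_pairedI continuous_map_prejoin_coords that)
  have pos: "openin ?P {z \<in> topspace ?P. snd z i \<in> {0<..}}" for i
    by (rule openin_continuous_map_preimage[OF continuous_map_prejoin_coords(2)]) auto
  have "{z \<in> topspace ?P.
     (\<forall>i<n. 0 < snd z i) \<and> k \<le> size (filter_mset (\<lambda>y. y \<in> V) (configuration n (fst z) (snd z)))}
     = (topspace ?P \<inter> (\<Inter>i<n. {z \<in> topspace ?P. snd z i \<in> {0<..}})) \<inter>
       (\<Union>I\<in>{I. I \<subseteq> {..<n} \<and> k \<le> card I}. topspace ?P \<inter> (\<Inter>i\<in>I. ?O i))" (is "?L = ?R")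
  proof (intro equalityI subsetI)
    fix z assume z: "z \<in> ?L"
    let ?I = "{i. i < n \<and> (fst z i, snd z i) \<in> V}"
    have "?I \<in> {I. I \<subseteq> {..<n} \<and> k \<le> card I}"
      using z by (auto simp: size_filter_configuration)
    moreover have "z \<in> topspace ?P \<inter> (\<Inter>i\<in>?I. ?O i)" using z by auto
    ultimately show "z \<in> ?R" using z by blast
  next
    fix z assume z: "z \<in> ?R"
    then obtain I where I: "I \<subseteq> {..<n}" "k \<le> card I" "z \<in> (\<Inter>i\<in>I. ?O i)" by blast
    have "card I \<le> card {i. i < n \<and> (fst z i, snd z i) \<in> V}"
      using I(1,3) by (intro card_mono) auto
    then show "z \<in> ?L" using z I(2) by (auto simp: size_filter_configuration)
  qed
  also have "openin ?P \<dots>"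
  proof (rule openin_Int[OF _ openin_Union])
    show "openin ?P (topspace ?P \<inter> (\<Inter>i<n. {z \<in> topspace ?P. snd z i \<in> {0<..}}))"
      using openin_INT[of "{..<n}" ?P "\<lambda>i. {z \<in> topspace ?P. snd z i \<in> {0<..}}"] pos
      by (simp add: Int_commute)
    fix D assume "D \<in> (\<lambda>I. topspace ?P \<inter> (\<Inter>i\<in>I. ?O i)) ` {I. I \<subseteq> {..<n} \<and> k \<le> card I}"
    then obtain I where "I \<subseteq> {..<n}" and D: "D = topspace ?P \<inter> (\<Inter>i\<in>I. ?O i)" by blast
    then have "openin ?P ((\<Inter>i\<in>I. ?O i) \<inter> topspace ?P)"
      by (intro openin_INT) (use O finite_subset in auto)
    then show "openin ?P D" by (simp add: D Int_commute)
  qed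
  finally show ?thesis .
qed

text \<open>The chosen representatives \<open>lift\<close> need not vary continuously, but their
  multiset of pairs does: the open conditions on it are independent of the representative and so
  descend through the quotient map. \<open>mset_path_lift\<close> then provides continuous
  coordinates.\<close>

theorem positive_path_lift:
  assumes X: "Hausdorff_space X" and n: "n \<ge> 1"
    and p: "pathin (symmetric_join X n) p" and pos: "\<And>s. 0 \<le> s \<Longrightarrow> s \<le> 1 \<Longrightarrow> 0 < min_weight X n (p s)"
  obtains x t where
    "\<And>i. i < n \<Longrightarrow> continuous_map (top_of_set {0..1}) X (x i)"
    "\<And>i. i < n \<Longrightarrow> continuous_on {0..1} (t i)"
    "\<And>s. 0 \<le> s \<Longrightarrow> s \<le> 1 \<Longrightarrow> join_coords X n (\<lambda>i. x i s) (\<lambda>i. t i s)"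
    "\<And>i s. i < n \<Longrightarrow> 0 \<le> s \<Longrightarrow> s \<le> 1 \<Longrightarrow> 0 < t i s"
    "\<And>s. 0 \<le> s \<Longrightarrow> s \<le> 1 \<Longrightarrow> p s = join_point X n (\<lambda>i. x i s) (\<lambda>i. t i s)"
proof -
  let ?S = "symmetric_join X n" and ?P = "prejoin X n" and ?Y = "prod_topology X euclideanreal"
  let ?M = "\<lambda>z. configuration n (fst z) (snd z)"
  define lift where "lift y = (SOME z. z \<in> topspace ?P \<and> join_class X n z = y)" for y
  have lift: "lift y \<in> topspace ?P" "join_class X n (lift y) = y" if "y \<in> topspace ?S" for y
  proof -
    have "\<exists>z. z \<in> topspace ?P \<and> join_class X n z = y"
      using quotient_imp_surjective_map[OF quotient_map_join_class, of X n] that by (metis imageE)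
    from someI_ex[OF this] show "lift y \<in> topspace ?P" "join_class X n (lift y) = y"
      by (auto simp: lift_def)
  qed
  have mw: "0 < min_weight X n (join_class X n z) \<longleftrightarrow> (\<forall>i<n. 0 < snd z i)" if "z \<in> topspace ?P" for z
  proof -
    have "{..<n} \<noteq> {}" using n by (simp add: lessThan_empty_iff)
    then show ?thesis
      using min_weight_join_point[OF n prejoin_coords(1)[OF n that]] prejoin_coords(2)[OF n that]
      by (simp, simp add: Ball_def)
  qed
  have Mlift: "?M (lift (join_class X n z)) = ?M z"
    if z: "z \<in> topspace ?P" "\<forall>i<n. 0 < snd z i" for z
  proof -
    have q: "join_class X n z \<in> topspace ?S"
      using quotient_imp_surjective_map[OF quotient_map_join_class, of X n] z(1) by blast
    show ?thesis
      by (rule configuration_eq_if_join_point_eq[OF n prejoin_coords(1)[OF n lift(1)[OF q]] prejoin_coords(1)[OF n z(1)]])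
        (use z lift(2)[OF q] prejoin_coords(2)[OF n lift(1)[OF q]] prejoin_coords(2)[OF n z(1)] in auto)
  qed
  \<comment> \<open>Extends the path to the whole line by constants, since multisets are lifted over
    the whole line.\<close>
  define cl where "cl s = max 0 (min 1 s)" for s :: real
  have cl: "0 \<le> cl s" "cl s \<le> 1" for s
    by (auto simp: cl_def clamp_bounds)
  have cl_id: "cl s = s" if "0 \<le> s" "s \<le> 1" for s
    using that by (simp add: cl_def)
  have pcl: "continuous_map euclideanreal ?S (\<lambda>s. p (cl s))"
  proof -
    have "continuous_on UNIV cl" unfolding cl_def[abs_def] by (intro continuous_intros)
    moreover have "range cl \<subseteq> {0..1}" using cl by auto
    ultimately have "continuous_map (top_of_set UNIV) ?S (\<lambda>s. p (cl s))"
      by (rule continuous_map_compose_unit[OF p[unfolded pathin_def]])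
    then show ?thesis by simp
  qed
  have pS: "p (cl s) \<in> topspace ?S" for s
    using continuous_map_image_subset_topspace[OF pcl] by auto
  let ?f = "\<lambda>s. ?M (lift (p (cl s)))"
  have posl: "\<forall>i<n. 0 < snd (lift (p (cl s))) i" for s
    using mw[OF lift(1)[OF pS[of s]]] lift(2)[OF pS[of s]] pos[OF cl] by simp
  have "mset_continuous ?Y ?f"
    unfolding mset_continuous_def
  proof (intro allI impI)
    fix V k assume V: "openin ?Y V"
    let ?O = "{y \<in> topspace ?S. 0 < min_weight X n y \<and> k \<le> size (filter_mset (\<lambda>y. y \<in> V) (?M (lift y)))}"
    have qS: "join_class X n z \<in> topspace ?S" if "z \<in> topspace ?P" for z
      using quotient_imp_surjective_map[OF quotient_map_join_class, of X n] that by blast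
    have eq: "{z \<in> topspace ?P. join_class X n z \<in> ?O} = {z \<in> topspace ?P.
        (\<forall>i<n. 0 < snd z i) \<and> k \<le> size (filter_mset (\<lambda>y. y \<in> V) (?M z))}"
    proof (intro Collect_cong conj_cong refl)
      fix z assume z: "z \<in> topspace ?P"
      show "join_class X n z \<in> ?O \<longleftrightarrow>
          (\<forall>i<n. 0 < snd z i) \<and> k \<le> size (filter_mset (\<lambda>y. y \<in> V) (?M z))"
      proof (cases "\<forall>i<n. 0 < snd z i")
        case True
        then show ?thesis unfolding mem_Collect_eq mw[OF z] Mlift[OF z True] using qS[OF z] by blast
      next
        case False
        then show ?thesis unfolding mem_Collect_eq mw[OF z] by blast
      qed
    qed
    have "openin ?P {z \<in> topspace ?P. join_class X n z \<in> ?O}"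
      unfolding eq by (rule openin_prejoin_configuration[OF V])
    moreover have "?O \<subseteq> topspace ?S" by blast
    ultimately have "openin ?S ?O"
      using conjunct2[OF quotient_map_join_class[of X n, unfolded quotient_map_def], rule_format, of ?O] by simp
    from openin_continuous_map_preimage[OF pcl this]
    have "open {s. p (cl s) \<in> ?O}" by simp
    moreover have "{s. p (cl s) \<in> ?O} = {s. k \<le> size (filter_mset (\<lambda>y. y \<in> V) (?f s))}"
      using pS pos cl by blast
    ultimately show "open {s. k \<le> size (filter_mset (\<lambda>y. y \<in> V) (?f s))}" by simp
  qed
  moreover have "size (?f s) = n" for s
    by (simp add: configuration_def)
  moreover have "set_mset (?f s) \<subseteq> topspace ?Y" for s
    using prejoin_coords(1)[OF n lift(1)[OF pS[of s]]] by (auto simp: configuration_def join_coords_def)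
  moreover have "Hausdorff_space ?Y"
    using X by (simp add: Hausdorff_space_prod_topology)
  ultimately obtain y where y: "\<And>i. i < n \<Longrightarrow> continuous_map euclideanreal ?Y (y i)"
    "\<And>s. ?f s = image_mset (\<lambda>i. y i s) (mset_set {..<n})"
    using mset_path_lift[of ?Y ?f n] by blast
  have pt: "join_coords X n (\<lambda>i. fst (y i s)) (\<lambda>i. snd (y i s)) \<and> (\<forall>i<n. 0 < snd (y i s)) \<and>
      p s = join_point X n (\<lambda>i. fst (y i s)) (\<lambda>i. snd (y i s))" if s: "0 \<le> s" "s \<le> 1" for s
  proof -
    let ?z = "lift (p s)"
    have ps: "p s \<in> topspace ?S" using pS[of s] cl_id[OF s] by simp
    note z = lift[OF ps]
    have "image_mset (\<lambda>i. y i s) (mset_set {..<n}) = image_mset (\<lambda>i. (fst ?z i, snd ?z i)) (mset_set {..<n})"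
      using y(2)[of s] cl_id[OF s] by (simp add: configuration_def)
    \<comment> \<open>Equal multisets of families differ by a permutation of the slots, so the
      lifted coordinates represent the same point as \<open>?z\<close>.\<close>
    then obtain \<sigma> where \<sigma>: "\<sigma> permutes {..<n}" "\<forall>i\<in>{..<n}. y i s = (fst ?z (\<sigma> i), snd ?z (\<sigma> i))"
      by (rule image_mset_eq_implies_permutes[OF finite_lessThan])
    note perm = join_coords_permute[OF n prejoin_coords(1)[OF n z(1)] \<sigma>(1)]
    have "join_coords X n (\<lambda>i. fst (y i s)) (\<lambda>i. snd (y i s))"
      using perm(1) \<sigma>(2) join_coords_cong(1)[of n "\<lambda>i. fst (y i s)" "fst ?z \<circ> \<sigma>" "\<lambda>i. snd (y i s)" "snd ?z \<circ> \<sigma>" X]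
      by simp
    moreover have "p s = join_point X n (\<lambda>i. fst (y i s)) (\<lambda>i. snd (y i s))"
      using perm(2) \<sigma>(2) join_coords_cong(2)[of n "\<lambda>i. fst (y i s)" "fst ?z \<circ> \<sigma>" "\<lambda>i. snd (y i s)" "snd ?z \<circ> \<sigma>" X]
        prejoin_coords(2)[OF n z(1)] z(2) by simp
    moreover have "0 < snd (y i s)" if "i < n" for i
      using \<sigma> that posl[of s] cl_id[OF s] permutes_in_image[OF \<sigma>(1), of i] by simp
    ultimately show ?thesis by blast
  qed
  show thesis
  proof (rule that[of "\<lambda>i s. fst (y i s)" "\<lambda>i s. snd (y i s)"])
    fix i assume i: "i < n"
    show "continuous_map (top_of_set {0..1}) X (\<lambda>s. fst (y i s))"
      using continuous_map_compose[OF y(1)[OF i] continuous_map_fst]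
      by (simp add: o_def continuous_map_from_subtopology)
    have "continuous_map euclideanreal euclideanreal (\<lambda>s. snd (y i s))"
      using continuous_map_compose[OF y(1)[OF i] continuous_map_snd] by (simp add: o_def)
    then show "continuous_on {0..1} (\<lambda>s. snd (y i s))"
      using continuous_on_subset by auto
  qed (use pt in auto)
qed

section \<open>Shrinking a lifted loop along an edge of the simplex\<close>

definition edge :: "nat \<Rightarrow> real \<Rightarrow> nat \<Rightarrow> real" where
  "edge k s i = (if i = 0 then 1 - s else 0) + (if i = k then s else 0)"

lemma sum_edge: "n \<ge> 1 \<Longrightarrow> k < n \<Longrightarrow> (\<Sum>i<n. edge k s i) = 1"
  by (simp add: edge_def sum.distrib sum.delta)

lemma join_coords_edge:
  assumes "n \<ge> 1" "k < n" "0 \<le> s" "s \<le> 1" "\<And>i. i < n \<Longrightarrow> x i \<in> topspace X"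
  shows "join_coords X n x (edge k s)"
  using assms sum_edge[OF assms(1,2)] by (simp add: join_coords_def edge_def)

text \<open>The lift ends where it began up to \<open>\<sigma>\<close>. The convex combination
  \<open>w\<close> moves the weights to the edge from vertex \<open>0\<close> to vertex
  \<open>k\<close>, and afterwards only the slots \<open>0\<close> and \<open>k\<close> can carry
  weight.\<close>

theorem positive_loop_null:
  assumes X: "Hausdorff_space X" and x0: "x0 \<in> topspace X" and n: "n \<ge> 2"
  defines "S \<equiv> symmetric_join X n"
  assumes p: "pathin S p" "p 0 = p 1" and pos: "\<And>s. 0 \<le> s \<Longrightarrow> s \<le> 1 \<Longrightarrow> 0 < min_weight X n (p s)"
  shows "path_homotopic S (p 0) (p 0) p (\<lambda>_. p 0)"
proof -
  let ?L = "homotopic_with (\<lambda>r. r 0 = r 1) (top_of_set {0..1::real}) S"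
  let ?j = "join_point X n"
  let ?T = "top_of_set unit_square"
  have n1: "n \<ge> 1" using n by simp
  obtain x t where x: "\<And>i. i < n \<Longrightarrow> continuous_map (top_of_set {0..1}) X (x i)"
    and t: "\<And>i. i < n \<Longrightarrow> continuous_on {0..1} (t i)"
    and c: "\<And>s. 0 \<le> s \<Longrightarrow> s \<le> 1 \<Longrightarrow> join_coords X n (\<lambda>i. x i s) (\<lambda>i. t i s)"
    and tpos: "\<And>i s. i < n \<Longrightarrow> 0 \<le> s \<Longrightarrow> s \<le> 1 \<Longrightarrow> 0 < t i s"
    and pj: "\<And>s. 0 \<le> s \<Longrightarrow> s \<le> 1 \<Longrightarrow> p s = ?j (\<lambda>i. x i s) (\<lambda>i. t i s)"
    using positive_path_lift[OF X n1 p(1)[unfolded S_def] pos] by blast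
  have xX: "x i s \<in> topspace X" if "i < n" "0 \<le> s" "s \<le> 1" for i s
    using c[OF that(2,3)] that(1) by (simp add: join_coords_def)
  have "?j (\<lambda>i. x i 0) (\<lambda>i. t i 0) = ?j (\<lambda>i. x i 1) (\<lambda>i. t i 1)"
    using p(2) pj[of 0] pj[of 1] by simp
  then obtain \<sigma> where \<sigma>: "\<sigma> permutes {..<n}" "\<And>i. i < n \<Longrightarrow> t i 1 = t (\<sigma> i) 0"
    "\<And>i. i < n \<Longrightarrow> x i 1 = x (\<sigma> i) 0"
    using tpos[of _ 1] unfolding join_point_eq_iff[OF n1 c[OF order_refl zero_le_one] c[OF zero_le_one order_refl]]
    by (metis order_refl zero_le_one less_irrefl)
  \<comment> \<open>This choice of \<open>k\<close> gives
    \<open>edge k 1 i = edge k 0 (\<sigma> i)\<close>, so \<open>\<sigma>\<close> identifies both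
    ends of every intermediate path as it does for the original lift. It also gives
    \<open>x k 1 = x 0 0\<close>.\<close>
  have "0 \<in> \<sigma> ` {..<n}" using permutes_image[OF \<sigma>(1)] n by simp
  then obtain k where k: "k < n" "\<sigma> k = 0" by auto
  have \<sigma>0: "\<sigma> i = 0 \<longleftrightarrow> i = k" for i
    using permutes_inj[OF \<sigma>(1)] k(2) by (metis injD)
  note xk = \<sigma>(3)[OF k(1), unfolded k(2)]
  have cedge: "join_coords X n y (edge k s)" if "0 \<le> s" "s \<le> 1" "\<And>i. i < n \<Longrightarrow> y i \<in> topspace X" for y s
    by (rule join_coords_edge[OF n1 k(1) that])
  have contedge: "continuous_on unit_square (\<lambda>w. edge k (g w) i)" if "continuous_on unit_square g" for g i
    using that unfolding edge_def
    by (cases "i = 0"; cases "i = k") (auto intro!: continuous_intros)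
  define w where "w u s i = (1 - u) * t i s + u * edge k s i" for u s i
  have cw: "join_coords X n (\<lambda>i. x i s) (w u s)" if "0 \<le> u" "u \<le> 1" "0 \<le> s" "s \<le> 1" for u s
    unfolding join_coords_def
  proof (intro conjI allI impI)
    have "(\<Sum>i<n. w u s i) = (1 - u) * (\<Sum>i<n. t i s) + u * (\<Sum>i<n. edge k s i)"
      by (simp add: w_def sum.distrib sum_distrib_left)
    then show "(\<Sum>i<n. w u s i) = 1"
      using c[OF that(3,4)] sum_edge[OF n1 k(1)] by (simp add: join_coords_def)
    show "0 \<le> w u s i" if "i < n" for i
      unfolding w_def using \<open>0 \<le> u\<close> \<open>u \<le> 1\<close> tpos[OF \<open>i < n\<close> \<open>0 \<le> s\<close> \<open>s \<le> 1\<close>] \<open>0 \<le> s\<close> \<open>s \<le> 1\<close>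
      by (intro add_nonneg_nonneg mult_nonneg_nonneg) (auto simp: edge_def)
  qed (use xX that in auto)
  have 1: "?L p (\<lambda>s. ?j (\<lambda>i. x i s) (edge k s))"
  proof (rule free_homotopyI)
    show "continuous_map ?T S (\<lambda>v. ?j (\<lambda>i. x i (snd v)) (\<lambda>i. w (fst v) (snd v) i))"
      unfolding S_def
    proof (rule continuous_map_join_point[OF n1])
      fix i assume i: "i < n"
      show "continuous_map ?T X (\<lambda>v. x i (snd v))"
        by (rule continuous_map_compose_unit[OF x[OF i]]) (auto intro!: continuous_intros)
      have "continuous_on unit_square (\<lambda>v. t i (snd v))"
        by (rule continuous_on_compose2[OF t[OF i]]) (auto intro!: continuous_intros)
      then show "continuous_map ?T euclideanreal (\<lambda>v. w (fst v) (snd v) i)"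
        unfolding w_def using contedge[of snd i, OF continuous_on_snd[OF continuous_on_id]] by (auto intro!: continuous_intros)
    qed (use cw in auto)
    fix u :: real assume u: "0 \<le> u" "u \<le> 1"
    have "?j (\<lambda>i. x i 0) (w u 0) = ?j (\<lambda>i. x i 1) (w u 1)"
      by (rule join_point_eqI[OF n1 _ _ \<sigma>(1)])
        (use cw u \<sigma>(2,3) in \<open>auto simp: w_def edge_def \<sigma>0\<close>)
    then show "?j (\<lambda>i. x i (snd (u, 0))) (\<lambda>i. w (fst (u, 0)) (snd (u, 0)) i) =
        ?j (\<lambda>i. x i (snd (u, 1))) (\<lambda>i. w (fst (u, 1)) (snd (u, 1)) i)" by simp
  next
    fix s :: real assume "0 \<le> s" "s \<le> 1"
    then show "?j (\<lambda>i. x i (snd (0, s))) (\<lambda>i. w (fst (0, s)) (snd (0, s)) i) = p s"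
      by (simp add: w_def pj)
    show "?j (\<lambda>i. x i (snd (1, s))) (\<lambda>i. w (fst (1, s)) (snd (1, s)) i) = ?j (\<lambda>i. x i s) (edge k s)"
      by (simp add: w_def)
  qed
  have "\<exists>z. ?L (\<lambda>s. ?j (\<lambda>i. x i s) (edge k s)) (\<lambda>_. z)"
  proof (cases "k = 0")
    case True
    \<comment> \<open>For \<open>k = 0\<close> the two terms of \<open>edge\<close> add up to the
      constant vertex \<open>0\<close>. Slot \<open>1\<close> exists and is empty, so the loop has
      minimal weight zero and falls under the contraction of \<open>?A\<close>.\<close>
    let ?A = "{y \<in> topspace S. min_weight X n y < 1 / n}"
    have q: "pathin S (\<lambda>s. ?j (\<lambda>i. x i s) (edge k s))"
      "?j (\<lambda>i. x i 0) (edge k 0) = ?j (\<lambda>i. x i 1) (edge k 1)"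
      using homotopic_with_imp_continuous_maps[OF 1] homotopic_with_imp_property[OF 1]
      by (simp_all add: pathin_def)
    have "?j (\<lambda>i. x i s) (edge k s) \<in> ?A" if s: "0 \<le> s" "s \<le> 1" for s
    proof -
      have "min_weight X n (?j (\<lambda>i. x i s) (edge k s)) = Min (edge k s ` {..<n})"
        by (rule min_weight_join_point[OF n1 cedge]) (use s xX in auto)
      also have "\<dots> \<le> edge k s 1" using n by (intro Min_le) auto
      also have "\<dots> < 1 / n" using n True by (simp add: edge_def)
      finally show ?thesis
        using q(1) s continuous_map_image_subset_topspace[of "top_of_set {0..1}" S] unfolding pathin_def by fastforce
    qed
    then have "(\<lambda>s. ?j (\<lambda>i. x i s) (edge k s)) ` {0..1} \<subseteq> ?A" by auto
    then show ?thesis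
      using noncentral_contractible[OF n1 x0] free_homotopic_const_if_contractible[OF _ q] unfolding S_def by blast
  next
    case False
    let ?\<tau> = "Transposition.transpose 0 k"
    have \<tau>: "?\<tau> permutes {..<n}" using k(1) n by (intro permutes_swap_id) auto
    let ?b = "x 0 0"
    \<comment> \<open>The parameter of the point in slot \<open>0\<close> shrinks towards 0 and that
      of slot \<open>k\<close> towards 1. Each point stays fixed at the end where it has full
      weight, and both reach \<open>?b\<close> because \<open>x k 1 = x 0 0\<close>.\<close>
    define y where "y u s i = (if i = 0 then x 0 ((1 - u) * s) else if i = k then x k (1 - (1 - u) * (1 - s)) else x i s)"
      for u s i
    have unit: "0 \<le> (1 - u) * s" "(1 - u) * s \<le> 1" if "0 \<le> u" "u \<le> 1" "0 \<le> s" "s \<le> 1" for u s :: real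
      using that mult_le_one[of "1 - u" s] by auto
    have yX: "y u s i \<in> topspace X" if "0 \<le> u" "u \<le> 1" "0 \<le> s" "s \<le> 1" "i < n" for u s i
      using unit[of u s] unit[of u "1 - s"] that n xX[of 0] xX[of k] xX[of i] by (auto simp: y_def)
    \<comment> \<open>A point of weight zero may move freely, so both moving points can be contracted to \<open>?b\<close> from the ends
      where they carry no weight.\<close>
    have 2: "?L (\<lambda>s. ?j (\<lambda>i. x i s) (edge k s)) (\<lambda>s. ?j (y 1 s) (edge k s))"
    proof (rule free_homotopyI)
      show "continuous_map ?T S (\<lambda>v. ?j (\<lambda>i. y (fst v) (snd v) i) (\<lambda>i. edge k (snd v) i))"
        unfolding S_def
      proof (rule continuous_map_join_point[OF n1])
        fix i assume i: "i < n"
        consider "i = 0" | "i = k" "i \<noteq> 0" | "i \<noteq> 0" "i \<noteq> k" by blast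
        then show "continuous_map ?T X (\<lambda>v. y (fst v) (snd v) i)"
        proof cases
          case 1
          have "continuous_map ?T X (\<lambda>v. x 0 ((1 - fst v) * snd v))"
            by (rule continuous_map_compose_unit[OF x]) (use n unit in \<open>auto intro!: continuous_intros\<close>)
          then show ?thesis by (simp add: y_def 1)
        next
          case 2
          have "continuous_map ?T X (\<lambda>v. x k (1 - (1 - fst v) * (1 - snd v)))"
            by (rule continuous_map_compose_unit[OF x[OF k(1)]])
              (use unit[of _ "1 - _"] in \<open>auto intro!: continuous_intros\<close>)
          then show ?thesis using 2 by (simp add: y_def)
        next
          case 3
          have "continuous_map ?T X (\<lambda>v. x i (snd v))"
            by (rule continuous_map_compose_unit[OF x[OF i]]) (auto intro!: continuous_intros)
          then show ?thesis using 3 by (simp add: y_def)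
        qed
        show "continuous_map ?T euclideanreal (\<lambda>v. edge k (snd v) i)"
          using contedge[of snd i, OF continuous_on_snd[OF continuous_on_id]] by simp
      qed (use cedge yX in auto)
      fix u :: real assume u: "0 \<le> u" "u \<le> 1"
      have "?j (y u 0) (edge k 0) = ?j (y u 1) (edge k 1)"
        by (rule join_point_eqI[OF n1 _ _ \<tau>])
          (use cedge yX u False xk in \<open>auto simp: edge_def y_def Transposition.transpose_def\<close>)
      then show "?j (\<lambda>i. y (fst (u, 0)) (snd (u, 0)) i) (\<lambda>i. edge k (snd (u, 0)) i) =
          ?j (\<lambda>i. y (fst (u, 1)) (snd (u, 1)) i) (\<lambda>i. edge k (snd (u, 1)) i)" by simp
    next
      fix s :: real assume "0 \<le> s" "s \<le> 1"
      have "y 0 s = (\<lambda>i. x i s)" by (auto simp: y_def fun_eq_iff)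
      then show "?j (\<lambda>i. y (fst (0, s)) (snd (0, s)) i) (\<lambda>i. edge k (snd (0, s)) i) = ?j (\<lambda>i. x i s) (edge k s)"
        by simp
    qed simp
    have b: "?b \<in> topspace X" using xX[of 0 0] n by simp
    have y1: "edge k s i \<noteq> 0 \<Longrightarrow> y 1 s i = ?b" for s i
      using xk by (auto simp: edge_def y_def split: if_splits)
    \<comment> \<open>With both points at \<open>?b\<close> the weights \<open>(1 - s, s)\<close> and \<open>(s, 1 - s)\<close> agree in the symmetric join, so the loop
      runs along a path and back.\<close>
    have 3: "?L (\<lambda>s. ?j (y 1 s) (edge k s)) (\<lambda>s. ?j (\<lambda>_. ?b) (edge k 0))"
    proof (rule free_homotopyI)
      \<comment> \<open>A tent function scaled down to zero. It vanishes at both ends throughout, so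
        the loop stays closed.\<close>
      let ?m = "\<lambda>v. (1 - fst v) * min (snd v) (1 - snd v)"
      have m: "0 \<le> ?m v" "?m v \<le> 1" if "v \<in> unit_square" for v
        using unit[of "fst v" "min (snd v) (1 - snd v)"] that by auto
      show "continuous_map ?T S (\<lambda>v. ?j (\<lambda>i. ?b) (\<lambda>i. edge k (?m v) i))"
        unfolding S_def
        by (rule continuous_map_join_point[OF n1])
          (use m b cedge in \<open>auto intro!: contedge continuous_intros\<close>)
      fix u :: real
      show "?j (\<lambda>i. ?b) (\<lambda>i. edge k (?m (u, 0)) i) = ?j (\<lambda>i. ?b) (\<lambda>i. edge k (?m (u, 1)) i)" by simp
    next
      fix s :: real assume s: "0 \<le> s" "s \<le> 1"
      have cy: "join_coords X n (y 1 s) (edge k s)" using cedge yX s by simp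
      show "?j (\<lambda>i. ?b) (\<lambda>i. edge k ((1 - fst (0, s)) * min (snd (0, s)) (1 - snd (0, s))) i) = ?j (y 1 s) (edge k s)"
      proof (cases "s \<le> 1/2")
        case True
        then have m: "min s (1 - s) = s" by auto
        have "?j (\<lambda>i. ?b) (edge k s) = ?j (y 1 s) (edge k s)"
          by (rule join_point_eqI[OF n1 _ cy permutes_id]) (use cedge s b y1 in auto)
        then show ?thesis by (simp add: m)
      next
        case gt: False
        then have m: "min s (1 - s) = 1 - s" by auto
        have "edge k s i = edge k (1 - s) (?\<tau> i)" for i
          using False by (auto simp: edge_def Transposition.transpose_def)
        then have "?j (\<lambda>i. ?b) (edge k (1 - s)) = ?j (y 1 s) (edge k s)"
          by (intro join_point_eqI[OF n1 _ cy \<tau>]) (use cedge s b y1 in auto)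
        then show ?thesis by (simp add: m)
      qed
    qed simp
    from homotopic_with_trans[OF 2 3] show ?thesis by blast
  qed
  then obtain z where "?L (\<lambda>s. ?j (\<lambda>i. x i s) (edge k s)) (\<lambda>_. z)" ..
  from homotopic_with_trans[OF 1 this] show ?thesis
    by (rule loop_nullhomotopic_if_free_homotopic)
qed

text \<open>The base point has minimal weight \<open>1 / (2 * n - 1)\<close>, strictly between 0 and
  \<open>1 / n\<close> for \<open>n \<ge> 2\<close>, so it lies in both sets. Its minimum sits in
  the last slot, as does that of the chosen representative of \<open>y\<close>; linear interpolation
  of the weights keeps it there, so the minimal weight of the path interpolates linearly and
  inherits the strict bounds. The points move along paths of \<open>X\<close> from
  \<open>x0\<close>.\<close>

lemma symmetric_join_base_path:
  assumes X: "path_connected_space X" and x0: "x0 \<in> topspace X" and n: "n \<ge> 2"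
  defines "e \<equiv> join_point X n (\<lambda>_. x0) (\<lambda>i. (if i = n - 1 then 1 else 2) / (2 * real n - 1))"
  assumes y: "y \<in> topspace (symmetric_join X n)"
  shows "\<exists>c. pathin (symmetric_join X n) c \<and> c 0 = e \<and> c 1 = y \<and>
     (min_weight X n y < 1 / n \<longrightarrow> (\<forall>s\<in>{0..1}. min_weight X n (c s) < 1 / n)) \<and>
     (0 < min_weight X n y \<longrightarrow> (\<forall>s\<in>{0..1}. 0 < min_weight X n (c s)))"
proof -
  have n1: "n \<ge> 1" using n by simp
  obtain x t where xt: "join_coords X n x t" "last_min n t" "y = join_point X n x t"
    by (rule join_point_last_min[OF n1 y])
  have "\<exists>g. pathin X g \<and> g 0 = x0 \<and> g 1 = x i" if "i < n" for i
    using X x0 xt(1) that unfolding path_connected_space_def join_coords_def by blast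
  then obtain g where g: "\<And>i. i < n \<Longrightarrow> pathin X (g i) \<and> g i 0 = x0 \<and> g i 1 = x i"
    by metis
  define r where "r i = (if i = n - 1 then 1 else 2) / (2 * real n - 1)" for i
  have r: "0 < r i" "r (n - 1) \<le> r i" for i
    using n by (auto simp: r_def field_simps)
  have "(\<Sum>i<n. if i = n - 1 then 1 else (2::real)) = (\<Sum>i<n. 2 - (if i = n - 1 then 1 else 0))"
    by (intro sum.cong) auto
  also have "\<dots> = 2 * n - 1"
    using n by (simp add: sum_subtractf sum.delta)
  finally have "(\<Sum>i<n. if i = n - 1 then 1 else (2::real)) = 2 * n - 1" .
  then have rsum: "(\<Sum>i<n. r i) = 1"
    unfolding r_def sum_divide_distrib[symmetric] using n by simp
  have rn: "r (n - 1) < 1 / n" using n by (simp add: r_def field_simps)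
  define w where "w s i = (1 - s) * r i + s * t i" for s i
  have gX: "g i s \<in> topspace X" if "i < n" "0 \<le> s" "s \<le> 1" for i s
    using g[OF that(1)] that continuous_map_image_subset_topspace[of "top_of_set {0..1}" X "g i"]
    unfolding pathin_def by auto
  have cw: "join_coords X n (\<lambda>i. g i s) (w s)" if s: "0 \<le> s" "s \<le> 1" for s
    unfolding join_coords_def
  proof (intro conjI allI impI)
    have "(\<Sum>i<n. w s i) = (1 - s) * (\<Sum>i<n. r i) + s * (\<Sum>i<n. t i)"
      by (simp add: w_def sum.distrib sum_distrib_left)
    then show "(\<Sum>i<n. w s i) = 1"
      using rsum xt(1) by (simp add: join_coords_def)
    show "0 \<le> w s i" if "i < n" for i
      unfolding w_def using s r(1)[of i] xt(1) that
      by (intro add_nonneg_nonneg mult_nonneg_nonneg) (auto simp: join_coords_def)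
  qed (use gX s in auto)
  have lw: "last_min n (w s)" if s: "0 \<le> s" "s \<le> 1" for s
    unfolding last_min_def w_def using s r(2) xt(2)
    by (auto simp: last_min_def intro!: add_mono mult_left_mono)
  have mw: "min_weight X n (join_point X n (\<lambda>i. g i s) (w s)) = w s (n - 1)" if s: "0 \<le> s" "s \<le> 1" for s
    by (rule min_weight_last_min[OF n1 cw[OF s] lw[OF s]])
  have my: "min_weight X n y = t (n - 1)"
    using min_weight_last_min[OF n1 xt(1,2)] xt(3) by simp
  let ?c = "\<lambda>s. join_point X n (\<lambda>i. g i s) (\<lambda>i. w s i)"
  have "pathin (symmetric_join X n) ?c"
    unfolding pathin_def
  proof (rule continuous_map_join_point[OF n1])
    show "continuous_map (top_of_set {0..1}) euclideanreal (\<lambda>s. w s i)" for i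
      unfolding w_def by (auto intro!: continuous_intros)
  qed (use g cw in \<open>auto simp: pathin_def\<close>)
  moreover have "?c 0 = e"
    unfolding e_def by (rule join_coords_cong(2)) (use g n in \<open>auto simp: w_def r_def\<close>)
  moreover have "?c 1 = y"
    unfolding xt(3) by (rule join_coords_cong(2)) (use g in \<open>auto simp: w_def\<close>)
  moreover have "w s (n - 1) < 1 / n" if "0 \<le> s" "s \<le> 1" "t (n - 1) < 1 / n" for s
    unfolding w_def using that rn by (intro convex_bound_lt) auto
  moreover have "0 < w s (n - 1)" if s: "0 \<le> s" "s \<le> 1" and t: "0 < t (n - 1)" for s
  proof (cases "s = 0")
    case False
    then have "0 < s * t (n - 1)" using s t by simp
    moreover have "0 \<le> (1 - s) * r (n - 1)" using s r(1)[of "n - 1"] by simp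
    ultimately show ?thesis by (simp add: w_def)
  qed (use r in \<open>simp add: w_def\<close>)
  ultimately show ?thesis
    using mw my by (intro exI[of _ ?c]) auto
qed

theorem theorem3p6:
  fixes X :: "'a topology" and x0 :: 'a and n :: nat
  assumes "x0 \<in> topspace X"
    and "path_connected_space X"
    and "locally_compact_space X"
    and "Hausdorff_space X"
    and "n \<ge> 2"
  shows "simply_connected_space (symmetric_join X n)"
proof -
  let ?S = "symmetric_join X n"
  let ?A = "{y \<in> topspace ?S. min_weight X n y \<in> {..<1 / n}}"
  let ?B = "{y \<in> topspace ?S. min_weight X n y \<in> {0<..}}"
  let ?e = "join_point X n (\<lambda>_. x0) (\<lambda>i. (if i = n - 1 then 1 else 2) / (2 * real n - 1))"
  have n1: "n \<ge> 1" using assms(5) by simp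
  note path = symmetric_join_base_path[OF assms(2,1,5)]
  have top: "c s \<in> topspace ?S" if "pathin ?S c" "0 \<le> s" "s \<le> 1" for c s
    using that continuous_map_image_subset_topspace[of "top_of_set {0..1}" ?S c] unfolding pathin_def by auto
  show ?thesis
  proof (rule simply_connected_by_two_open_sets)
    show "openin ?S ?A" "openin ?S ?B"
      by (rule openin_continuous_map_preimage[OF continuous_map_min_weight[OF n1]]; simp)+
    show "?A \<union> ?B = topspace ?S"
    proof -
      have "0 < 1 / real n" using n1 by simp
      then have "m < 1 / real n \<or> 0 < m" for m :: real by linarith
      then show ?thesis by auto
    qed
    \<comment> \<open>Obtained as the starting point of a base path to some point of the join, which
      spares a separate computation of its weights.\<close>
    show "?e \<in> topspace ?S"
    proof -
      have "join_coords X n (\<lambda>_. x0) (\<lambda>i. if i = 0 then 1 else 0)"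
        using assms(1) n1 by (simp add: join_coords_def)
      then have "prejoin_point n (\<lambda>_. x0) (\<lambda>i. if i = 0 then 1 else 0) \<in> topspace (prejoin X n)"
        using topspace_prejoin[OF n1] by blast
      then obtain y where "y \<in> topspace ?S"
        using quotient_imp_surjective_map[OF quotient_map_join_class, of X n] by blast
      from path[OF this] obtain c where "pathin ?S c" "c 0 = ?e" by blast
      then show ?thesis using top[of c 0] by simp
    qed
    show "\<exists>c. pathin ?S c \<and> c 0 = ?e \<and> c 1 = y \<and> (y \<in> ?A \<longrightarrow> c ` {0..1} \<subseteq> ?A) \<and> (y \<in> ?B \<longrightarrow> c ` {0..1} \<subseteq> ?B)"
      if y: "y \<in> topspace ?S" for y
    proof -
      obtain c where c: "pathin ?S c" "c 0 = ?e" "c 1 = y"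
        "min_weight X n y < 1 / n \<longrightarrow> (\<forall>s\<in>{0..1}. min_weight X n (c s) < 1 / n)"
        "0 < min_weight X n y \<longrightarrow> (\<forall>s\<in>{0..1}. 0 < min_weight X n (c s))"
        using path[OF y] by blast
      have "(y \<in> ?A \<longrightarrow> c ` {0..1} \<subseteq> ?A) \<and> (y \<in> ?B \<longrightarrow> c ` {0..1} \<subseteq> ?B)"
        using c(4,5) top[OF c(1)] by (simp add: image_subset_iff)
      with c(1-3) show ?thesis by blast
    qed
    show "path_homotopic ?S (p 0) (p 0) p (\<lambda>_. p 0)"
      if p: "pathin ?S p" "p 0 = p 1" and "p ` {0..1} \<subseteq> ?A \<or> p ` {0..1} \<subseteq> ?B" for p
      using that(3)
    proof
      assume "p ` {0..1} \<subseteq> ?A"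
      then show ?thesis
        using noncentral_contractible[OF n1 assms(1)] free_homotopic_const_if_contractible[OF _ p]
          loop_nullhomotopic_if_free_homotopic by fastforce
    next
      assume "p ` {0..1} \<subseteq> ?B"
      then show ?thesis
        by (intro positive_loop_null[OF assms(4,1,5) p]) (simp add: image_subset_iff)
    qed
  qed
qed

end
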